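(* Let $n\ge2$, let $\Omega$ be an open subset of $\mathbb{R}^3$, and let $A\in\mathcal{C}^1(\Omega,\mathbb{C}^{n\times n})$ be Hermitian valued. Let $\lambda_1(\xi)\ge\dots\ge\lambda_n(\xi)$ be the continuous eigenvalues of $A(\xi)$. Suppose that, for some $h\in\{1,\dots,n-1\}$ and some $\xi_0\in\Omega$, $$\lambda_j(\xi)=\lambda_{j+1}(\xi)\ \text{ if and only if }\ j=h \text{ and } \xi=\xi_0 .$$ Then $\xi_0$ is a generic point of coalescence for the eigenvalues of $A$ if and only if $$\lim_{t\to0}\frac{\operatorname{discr}(A(\xi_0+tv))}{t^2}>0\quad\text{for any non-zero } v\in\mathbb{R}^3 .$$
   Context: Discriminant: for $B\in\mathbb{C}^{n\times n}$ with eigenvalues $\lambda_1,\dots,\lambda_n$ (with multiplicity), $\operatorname{discr}(B)=\prod_{\ell<j}(\lambda_j-\lambda_\ell)^2$. A regular zero of a $\mathcal{C}^1$ map $F$ from an open subset of $\mathbb{R}^p$ to $\mathbb{R}^p$ is a point $\xi_0$ with $F(\xi_0)=0$ and $DF(\xi_0)$ invertible. Generic point of coalescence: let $A\in\mathcal{C}^1(\Omega,\mathbb{C}^{n\times n})$ be Hermitian, $\Omega\subset\mathbb{R}^3$ open, with ordered eigenvalues $\lambda_1\ge\dots\ge\lambda_n$ such that $\lambda_j(\xi)=\lambda_{j+1}(\xi)$ iff $j=h$ and $\xi=\xi_0$. (i) If $n=2$, write $A(\xi)=\begin{bmatrix}a(\xi)&b(\xi)+ic(\xi)\\ b(\xi)-ic(\xi)&d(\xi)\end{bmatrix}$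 with $a,b,c,d$ real valued. Then $\xi_0$ is a generic point of coalescence for the eigenvalues of $A$ if it is a regular zero of $F(\xi)=(a(\xi)-d(\xi),\,b(\xi),\,c(\xi))$. (ii) If $n>2$, let $R\subset\Omega$ be a pluri-rectangular domain (a product of intervals) containing $\xi_0$ in its interior, and let $A(\xi)=U(\xi)\begin{bmatrix}P(\xi)&0\\0&\Lambda(\xi)\end{bmatrix}U^*(\xi)$ be a $\mathcal{C}^1$ block Schur decomposition on $R$ ($U$ unitary), where $\Lambda(\xi)=\operatorname{diag}(\lambda_1(\xi),\dots,\lambda_{h-1}(\xi),\lambda_{h+2}(\xi),\dots,\lambda_n(\xi))$ and $P(\xi)\in\mathbb{C}^{2\times2}$ is Hermitian with eigenvalues $\{\lambda_h(\xi),\lambda_{h+1}(\xi)\}$ for all $\xi\in R$ (such a decomposition exists). Then $\xi_0$ is a generic point of coalescence for the eigenvalues of $A$ if it is one for the eigenvalues of $P$ according to (i). *)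

theory Defs
  imports
    "HOL-Analysis.Analysis"
    "Jordan_Normal_Form.Char_Poly"
    "Jordan_Normal_Form.Schur_Decomposition"
begin

text \<open>
  Matrices of arbitrary size \<open>n\<close> are those of \<open>Jordan_Normal_Form\<close> (entries indexed from \<open>0\<close>);
  points of Euclidean space are vectors in \<open>real ^ 'p\<close>.
\<close>

subsection \<open>Continuously differentiable maps\<close>

text \<open>
  For open \<open>S\<close> the derivative within \<open>S\<close> is the ordinary one. The set \<open>S\<close> is not required to be
  open because block Schur decompositions below live on a product of intervals of any kind
  (one-sided derivatives on the boundary).
\<close>

definition C1_on :: "'a::real_normed_vector set \<Rightarrow> ('a \<Rightarrow> 'b::real_normed_vector) \<Rightarrow> bool" where
  "C1_on S f \<longleftrightarrow>
     (\<exists>f' :: 'a \<Rightarrow> 'a \<Rightarrow>\<^sub>L 'b.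
        (\<forall>x\<in>S. (f has_derivative blinfun_apply (f' x)) (at x within S)) \<and> continuous_on S f')"

definition C1_mat_on ::
    "nat \<Rightarrow> nat \<Rightarrow> 'a::real_normed_vector set \<Rightarrow> ('a \<Rightarrow> complex mat) \<Rightarrow> bool" where
  "C1_mat_on m n S A \<longleftrightarrow>
     (\<forall>x\<in>S. A x \<in> carrier_mat m n) \<and>
     (\<forall>i<m. \<forall>j<n. C1_on S (\<lambda>x. A x $$ (i, j)))"

definition regular_zero :: "(real ^ 'p) set \<Rightarrow> (real ^ 'p \<Rightarrow> real ^ 'p) \<Rightarrow> real ^ 'p \<Rightarrow> bool" where
  "regular_zero S F \<xi>0 \<longleftrightarrow>
     open S \<and> C1_on S F \<and> \<xi>0 \<in> S \<and> F \<xi>0 = 0 \<and> invertible (jacobian F (at \<xi>0))"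

subsection \<open>Hermitian and unitary matrices, eigenvalues, discriminant\<close>

definition hermitian_mat :: "nat \<Rightarrow> complex mat \<Rightarrow> bool" where
  "hermitian_mat n B \<longleftrightarrow> B \<in> carrier_mat n n \<and> mat_adjoint B = B"

definition unitary_mat :: "nat \<Rightarrow> complex mat \<Rightarrow> bool" where
  "unitary_mat n V \<longleftrightarrow> V \<in> carrier_mat n n \<and> mat_adjoint V * V = 1\<^sub>m n \<and> V * mat_adjoint V = 1\<^sub>m n"

text \<open>The list \<open>es\<close> enumerates the eigenvalues of \<open>B\<close>, repeated with algebraic multiplicity.\<close>

definition eigenvalue_list :: "complex mat \<Rightarrow> complex list \<Rightarrow> bool" where
  "eigenvalue_list B es \<longleftrightarrow> char_poly B = (\<Prod>e\<leftarrow>es. [:- e, 1:])"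

text \<open>
  The product does not depend on the chosen enumeration of the eigenvalues, and for square \<open>B\<close> an
  enumeration exists by \<open>char_poly_factorized\<close>.
\<close>

definition discr :: "complex mat \<Rightarrow> complex" where
  "discr B = (let es = (SOME es. eigenvalue_list B es) in
     \<Prod>(l, j) \<in> {(l, j). l < j \<and> j < length es}. (es ! j - es ! l)\<^sup>2)"

subsection \<open>Generic points of coalescence\<close>

text \<open>
  Case of \<open>2 \<times> 2\<close> Hermitian matrices, with \<open>a = Re (A $$ (0,0))\<close>, \<open>d = Re (A $$ (1,1))\<close> and
  \<open>b + \<i> c = A $$ (0,1)\<close>.
\<close>

definition generic_coalescence_2 ::
    "(real ^ 3) set \<Rightarrow> (real ^ 3 \<Rightarrow> complex mat) \<Rightarrow> real ^ 3 \<Rightarrow> bool" where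
  "generic_coalescence_2 \<Omega> A \<xi>0 \<longleftrightarrow>
     regular_zero \<Omega>
       (\<lambda>\<xi>. vector [Re (A \<xi> $$ (0, 0)) - Re (A \<xi> $$ (1, 1)), Re (A \<xi> $$ (0, 1)), Im (A \<xi> $$ (0, 1))])
       \<xi>0"

text \<open>
  The eigenvalues \<open>lam 1, \<dots>, lam n\<close> are indexed from \<open>1\<close>, whereas the diagonal entries of
  \<open>mat_diag\<close> are indexed from \<open>0\<close>: this is
  \<open>diag(lam 1, \<dots>, lam (h - 1), lam (h + 2), \<dots>, lam n)\<close>.
\<close>

definition remaining_diag ::
    "nat \<Rightarrow> nat \<Rightarrow> (nat \<Rightarrow> real ^ 3 \<Rightarrow> real) \<Rightarrow> real ^ 3 \<Rightarrow> complex mat" where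
  "remaining_diag n h lam \<xi> =
     mat_diag (n - 2) (\<lambda>i. complex_of_real (if i + 1 < h then lam (i + 1) \<xi> else lam (i + 3) \<xi>))"

definition C1_block_schur ::
    "nat \<Rightarrow> nat \<Rightarrow> (nat \<Rightarrow> real ^ 3 \<Rightarrow> real) \<Rightarrow> (real ^ 3 \<Rightarrow> complex mat) \<Rightarrow> (real ^ 3) set \<Rightarrow>
     (real ^ 3 \<Rightarrow> complex mat) \<Rightarrow> (real ^ 3 \<Rightarrow> complex mat) \<Rightarrow> bool" where
  "C1_block_schur n h lam A R U P \<longleftrightarrow>
     C1_mat_on n n R U \<and> C1_mat_on 2 2 R P \<and> C1_mat_on (n - 2) (n - 2) R (remaining_diag n h lam) \<and>
     (\<forall>\<xi>\<in>R. unitary_mat n (U \<xi>) \<and> hermitian_mat 2 (P \<xi>) \<and>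
        eigenvalue_list (P \<xi>) [complex_of_real (lam h \<xi>), complex_of_real (lam (h + 1) \<xi>)] \<and>
        A \<xi> = U \<xi> *
                four_block_mat (P \<xi>) (0\<^sub>m 2 (n - 2)) (0\<^sub>m (n - 2) 2) (remaining_diag n h lam \<xi>) *
                mat_adjoint (U \<xi>))"

text \<open>
  \<open>lam 1 \<ge> \<dots> \<ge> lam n\<close> are the ordered eigenvalues of \<open>A\<close>, and \<open>lam h\<close>, \<open>lam (h + 1)\<close> is the only
  pair that coalesces in \<open>\<Omega>\<close>, exactly at \<open>\<xi>0\<close>. A product of intervals is a set satisfying
  \<open>is_interval\<close>.
\<close>

definition generic_coalescence ::
    "nat \<Rightarrow> nat \<Rightarrow> (nat \<Rightarrow> real ^ 3 \<Rightarrow> real) \<Rightarrow> (real ^ 3) set \<Rightarrow> (real ^ 3 \<Rightarrow> complex mat) \<Rightarrow>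
     real ^ 3 \<Rightarrow> bool" where
  "generic_coalescence n h lam \<Omega> A \<xi>0 \<longleftrightarrow>
     (if n = 2 then generic_coalescence_2 \<Omega> A \<xi>0
      else (\<exists>R U P. is_interval R \<and> R \<subseteq> \<Omega> \<and> \<xi>0 \<in> interior R \<and>
              C1_block_schur n h lam A R U P \<and> generic_coalescence_2 (interior R) P \<xi>0))"

end

theory Submission
  imports Defs
begin

text \<open>
  Near \<open>\<xi>0\<close> only the factor \<open>(lam h - lam (h + 1))\<^sup>2\<close> of the discriminant is small: all other
  differences of eigenvalues stay away from \<open>0\<close>. Suppose that \<open>P\<close> is a \<open>2 \<times> 2\<close> Hermitian block whose
  eigenvalues are the two coalescing ones, and let \<open>F = (a - d, b, c)\<close> be the map attached to \<open>P\<close>. The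
  quadratic formula gives \<open>(lam h - lam (h + 1))\<^sup>2 = N F\<close> with the positive definite quadratic form
  \<open>N y = y\<^sub>1\<^sup>2 + 4 (y\<^sub>2\<^sup>2 + y\<^sub>3\<^sup>2)\<close>. Hence \<open>F \<xi>0 = 0\<close>, and as \<open>F\<close> is differentiable,
  \<open>discr (A (\<xi>0 + t v)) / t\<^sup>2\<close> tends to \<open>N (DF(\<xi>0) v)\<close> times a positive constant. These limits are
  positive for all \<open>v \<noteq> 0\<close> exactly when \<open>DF(\<xi>0)\<close> has trivial kernel, which for a square Jacobian means
  that it is invertible (lemma \<open>generic_coalescence_2_iff\<close>).

  For \<open>n = 2\<close> the block \<open>P\<close> is \<open>A\<close> itself. For \<open>n > 2\<close> the argument applies to every block Schur
  decomposition, so the only thing left is that at least one exists, and a small box around \<open>\<xi>0\<close>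
  suffices as its domain (lemma \<open>C1_block_schur_exists\<close>). The remaining
  eigenvalues are simple roots of the characteristic polynomial and are given as
  continuous functions, so they are continuously differentiable (lemma \<open>C1_on_simple_root\<close>). A
  continuously differentiable eigenvector for such an eigenvalue \<open>l\<close> is obtained by applying the
  adjugate of \<open>l I - A\<close> to a constant vector (lemma \<open>C1_eigenvector\<close>). The normalized eigenvectors are
  orthonormal because the eigenvalues are distinct, and two Gram-Schmidt steps complete them to an
  orthonormal basis (lemma \<open>C1_orthonormal_frame_extend\<close>). In this basis \<open>A\<close> has the required block form,
  since the orthogonal complement of a set of eigenvectors of a Hermitian matrix is invariant.
\<close>

section \<open>Continuously differentiable maps\<close>

text \<open>
  On a finite-dimensional domain a family of linear maps is continuous as soon as its values at each
  fixed vector are. With this criterion derivatives are handled as plain functions instead of bounded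
  linear operators.
\<close>

lemma C1_onI:
  fixes f :: "'a::euclidean_space \<Rightarrow> 'b::real_normed_vector"
  assumes D: "\<And>x. x \<in> S \<Longrightarrow> (f has_derivative D x) (at x within S)"
    and cont: "\<And>v. continuous_on S (\<lambda>x. D x v)"
  shows "C1_on S f"
proof -
  have app: "blinfun_apply (Blinfun (D x)) = D x" if "x \<in> S" for x
    using has_derivative_bounded_linear[OF D[OF that]] by (rule bounded_linear_Blinfun_apply)
  have "continuous_on S (\<lambda>x. Blinfun (D x))"
  proof (rule continuous_on_blinfun_componentwise)
    fix i :: 'a
    show "continuous_on S (\<lambda>x. blinfun_apply (Blinfun (D x)) i)"
      using cont[of i] by (rule continuous_on_eq) (simp add: app)
  qed
  then show ?thesis
    unfolding C1_on_def using D app by (intro exI[of _ "\<lambda>x. Blinfun (D x)"]) auto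
qed

lemma C1_onE:
  assumes "C1_on S f"
  obtains D where "\<And>x. x \<in> S \<Longrightarrow> (f has_derivative D x) (at x within S)"
    and "\<And>v. continuous_on S (\<lambda>x. D x v)"
proof -
  obtain f' where f': "\<forall>x\<in>S. (f has_derivative blinfun_apply (f' x)) (at x within S)"
    and c: "continuous_on S f'"
    using assms unfolding C1_on_def by blast
  show thesis
  proof (rule that)
    show "(f has_derivative blinfun_apply (f' x)) (at x within S)" if "x \<in> S" for x
      using f' that by blast
    show "continuous_on S (\<lambda>x. blinfun_apply (f' x) v)" for v
      using c by (intro continuous_intros)
  qed
qed

lemma C1_on_subset:
  assumes "C1_on S f" "T \<subseteq> S"
  shows "C1_on T f"
proof -
  obtain f' where "\<forall>x\<in>S. (f has_derivative blinfun_apply (f' x)) (at x within S)"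
    and "continuous_on S f'"
    using assms(1) unfolding C1_on_def by blast
  then show ?thesis
    using assms(2) has_derivative_subset continuous_on_subset
    unfolding C1_on_def by (intro exI[of _ f']) blast
qed

lemma C1_on_imp_continuous_on: "C1_on S f \<Longrightarrow> continuous_on S f"
  unfolding C1_on_def continuous_on_eq_continuous_within by (metis has_derivative_continuous)

lemma C1_on_cong:
  assumes "C1_on S f" "\<And>x. x \<in> S \<Longrightarrow> f x = g x"
  shows "C1_on S g"
proof -
  obtain f' where "\<forall>x\<in>S. (f has_derivative blinfun_apply (f' x)) (at x within S)"
    and "continuous_on S f'"
    using assms(1) unfolding C1_on_def by blast
  then show ?thesis
    using has_derivative_transform[where f = f and g = g, OF _ assms(2)[symmetric]]
    unfolding C1_on_def by (intro exI[of _ f']) simp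
qed

lemma C1_on_const: "C1_on S (\<lambda>x::'a::euclidean_space. c)"
  by (rule C1_onI[where D = "\<lambda>x v. 0"]) auto

lemma C1_on_ident: "C1_on S (\<lambda>x::'a::euclidean_space. x)"
  by (rule C1_onI[where D = "\<lambda>x v. v"]) (auto intro: has_derivative_ident)

lemma C1_on_linear:
  fixes f :: "'a::euclidean_space \<Rightarrow> 'b::real_normed_vector"
  assumes "bounded_linear T" "C1_on S f"
  shows "C1_on S (\<lambda>x. T (f x))"
proof -
  obtain D where D: "\<And>x. x \<in> S \<Longrightarrow> (f has_derivative D x) (at x within S)"
    and c: "\<And>v. continuous_on S (\<lambda>x. D x v)"
    by (rule C1_onE[OF assms(2)]) blast
  show ?thesis
  proof (rule C1_onI[where D = "\<lambda>x v. T (D x v)"])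
    show "((\<lambda>x. T (f x)) has_derivative (\<lambda>v. T (D x v))) (at x within S)" if "x \<in> S" for x
      using bounded_linear.has_derivative[OF assms(1) D[OF that]] .
    show "continuous_on S (\<lambda>x. T (D x v))" for v
      using bounded_linear.continuous_on[OF assms(1) c] .
  qed
qed

lemma C1_on_add:
  fixes f g :: "'a::euclidean_space \<Rightarrow> 'b::real_normed_vector"
  assumes "C1_on S f" "C1_on S g"
  shows "C1_on S (\<lambda>x. f x + g x)"
proof -
  obtain D where D: "\<And>x. x \<in> S \<Longrightarrow> (f has_derivative D x) (at x within S)"
    and c: "\<And>v. continuous_on S (\<lambda>x. D x v)"
    by (rule C1_onE[OF assms(1)]) blast
  obtain E where E: "\<And>x. x \<in> S \<Longrightarrow> (g has_derivative E x) (at x within S)"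
    and d: "\<And>v. continuous_on S (\<lambda>x. E x v)"
    by (rule C1_onE[OF assms(2)]) blast
  show ?thesis
    by (rule C1_onI[where D = "\<lambda>x v. D x v + E x v"])
      (auto intro!: has_derivative_add D E continuous_on_add c d)
qed

lemma C1_on_mult:
  fixes f g :: "'a::euclidean_space \<Rightarrow> 'b::real_normed_algebra"
  assumes "C1_on S f" "C1_on S g"
  shows "C1_on S (\<lambda>x. f x * g x)"
proof -
  obtain D where D: "\<And>x. x \<in> S \<Longrightarrow> (f has_derivative D x) (at x within S)"
    and c: "\<And>v. continuous_on S (\<lambda>x. D x v)"
    by (rule C1_onE[OF assms(1)]) blast
  obtain E where E: "\<And>x. x \<in> S \<Longrightarrow> (g has_derivative E x) (at x within S)"
    and d: "\<And>v. continuous_on S (\<lambda>x. E x v)"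
    by (rule C1_onE[OF assms(2)]) blast
  show ?thesis
    by (rule C1_onI[where D = "\<lambda>x v. f x * E x v + D x v * g x"])
      (auto intro!: has_derivative_mult D E continuous_on_add continuous_on_mult c d
        C1_on_imp_continuous_on[OF assms(1)] C1_on_imp_continuous_on[OF assms(2)])
qed

lemma C1_on_uminus:
  fixes f :: "'a::euclidean_space \<Rightarrow> 'b::real_normed_vector"
  shows "C1_on S f \<Longrightarrow> C1_on S (\<lambda>x. - f x)"
  by (rule C1_on_linear[OF bounded_linear_minus[OF bounded_linear_ident]])

lemma C1_on_diff:
  fixes f g :: "'a::euclidean_space \<Rightarrow> 'b::real_normed_vector"
  assumes "C1_on S f" "C1_on S g"
  shows "C1_on S (\<lambda>x. f x - g x)"
  using C1_on_add[OF assms(1) C1_on_uminus[OF assms(2)]] by simp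

lemma C1_on_sum:
  fixes f :: "'i \<Rightarrow> 'a::euclidean_space \<Rightarrow> 'b::real_normed_vector"
  assumes "\<And>i. i \<in> I \<Longrightarrow> C1_on S (f i)"
  shows "C1_on S (\<lambda>x. \<Sum>i\<in>I. f i x)"
  using assms by (induction I rule: infinite_finite_induct) (auto intro: C1_on_const C1_on_add)

lemma C1_on_prod:
  fixes f :: "'i \<Rightarrow> 'a::euclidean_space \<Rightarrow> 'b::real_normed_field"
  assumes "\<And>i. i \<in> I \<Longrightarrow> C1_on S (f i)"
  shows "C1_on S (\<lambda>x. \<Prod>i\<in>I. f i x)"
  using assms by (induction I rule: infinite_finite_induct) (auto intro: C1_on_const C1_on_mult)

lemmas C1_on_Re = C1_on_linear[OF bounded_linear_Re]
lemmas C1_on_Im = C1_on_linear[OF bounded_linear_Im]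
lemmas C1_on_cnj = C1_on_linear[OF bounded_linear_cnj]
lemmas C1_on_of_real = C1_on_linear[OF bounded_linear_of_real]

lemmas C1_on_intros = C1_on_const C1_on_add C1_on_diff C1_on_uminus C1_on_mult C1_on_sum C1_on_prod
  C1_on_Re C1_on_Im C1_on_cnj C1_on_of_real

text \<open>
  This is what makes the normalization of a nowhere vanishing vector field continuously differentiable.
\<close>

lemma C1_on_inverse_sqrt:
  fixes f :: "'a::euclidean_space \<Rightarrow> real"
  assumes f: "C1_on S f" and pos: "\<And>x. x \<in> S \<Longrightarrow> 0 < f x"
  shows "C1_on S (\<lambda>x. inverse (sqrt (f x)))"
proof -
  obtain D where D: "\<And>x. x \<in> S \<Longrightarrow> (f has_derivative D x) (at x within S)"
    and c: "\<And>v. continuous_on S (\<lambda>x. D x v)"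
    by (rule C1_onE[OF f]) blast
  let ?E = "\<lambda>x v. - (inverse (sqrt (f x)) * (D x v * (inverse (sqrt (f x)) / 2)) * inverse (sqrt (f x)))"
  show ?thesis
  proof (rule C1_onI[where D = ?E])
    fix x assume x: "x \<in> S"
    have "((\<lambda>x. sqrt (f x)) has_derivative (\<lambda>v. D x v * (inverse (sqrt (f x)) / 2))) (at x within S)"
      using has_derivative_real_sqrt[OF pos[OF x] D[OF x]] by simp
    then show "((\<lambda>x. inverse (sqrt (f x))) has_derivative ?E x) (at x within S)"
      by (rule Deriv.has_derivative_inverse[rotated]) (use pos[OF x] in auto)
  next
    fix v
    show "continuous_on S (\<lambda>x. ?E x v)"
      using pos by (intro continuous_intros c C1_on_imp_continuous_on[OF f]) (force+)
  qed
qed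

lemma C1_on_fst:
  fixes f :: "'a::euclidean_space \<Rightarrow> 'b::real_normed_vector"
  assumes "C1_on S f"
  shows "C1_on (S \<times> T) (\<lambda>p :: 'a \<times> 'c::euclidean_space. f (fst p))"
proof -
  obtain D where D: "\<And>x. x \<in> S \<Longrightarrow> (f has_derivative D x) (at x within S)"
    and c: "\<And>v. continuous_on S (\<lambda>x. D x v)"
    by (rule C1_onE[OF assms(1)]) blast
  show ?thesis
  proof (rule C1_onI[where D = "\<lambda>p v. D (fst p) (fst v)"])
    fix p :: "'a \<times> 'c" assume p: "p \<in> S \<times> T"
    have "(fst has_derivative fst) (at p within S \<times> T)"
      by (rule bounded_linear_imp_has_derivative[OF bounded_linear_fst])
    moreover have "(f has_derivative D (fst p)) (at (fst p) within fst ` (S \<times> T))"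
      using p by (intro has_derivative_subset[OF D]) auto
    ultimately show "((\<lambda>p. f (fst p)) has_derivative (\<lambda>v. D (fst p) (fst v))) (at p within S \<times> T)"
      using has_derivative_in_compose by blast
  next
    fix v :: "'a \<times> 'c"
    show "continuous_on (S \<times> T) (\<lambda>p. D (fst p) (fst v))"
      by (rule continuous_on_compose2[OF c continuous_on_fst[OF continuous_on_id]]) auto
  qed
qed

lemma C1_on_snd: "C1_on S (snd :: 'a::euclidean_space \<times> 'b::euclidean_space \<Rightarrow> 'b)"
  by (rule C1_onI[where D = "\<lambda>p. snd"])
    (auto intro: bounded_linear_imp_has_derivative bounded_linear_snd)

lemma C1_on_vector_3:
  fixes f g h :: "'a::euclidean_space \<Rightarrow> real"
  assumes "C1_on S f" "C1_on S g" "C1_on S h"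
  shows "C1_on S (\<lambda>x. vector [f x, g x, h x] :: real ^ 3)"
proof -
  have eq: "(vector [a, b, c] :: real ^ 3) = a *\<^sub>R axis 1 1 + b *\<^sub>R axis 2 1 + c *\<^sub>R axis 3 1"
    for a b c :: real
    by (simp add: Finite_Cartesian_Product.vec_eq_iff forall_3 axis_def)
  have "C1_on S (\<lambda>x. f x *\<^sub>R axis 1 1 + g x *\<^sub>R axis 2 1 + h x *\<^sub>R (axis 3 1 :: real ^ 3))"
    by (intro C1_on_add C1_on_linear[OF bounded_linear_scaleR_left] assms)
  then show ?thesis
    unfolding eq .
qed

text \<open>
  At a zero of \<open>f\<close> the product rule for \<open>f r\<close> has no term containing the derivative of \<open>r\<close>, so mere
  continuity of \<open>r\<close> at that point is enough. The error splits as
  \<open>(f x - f' (x - a)) r x + f' (x - a) (r x - c)\<close>, where the first summand is small because \<open>f\<close> is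
  differentiable and the second because \<open>r\<close> is continuous.
\<close>

lemma has_derivative_mult_continuous_zero:
  fixes f r :: "'a::real_normed_vector \<Rightarrow> 'b::real_normed_algebra"
  assumes f: "(f has_derivative f') (at a within S)" and f0: "f a = 0"
    and r: "(r \<longlongrightarrow> c) (at a within S)" and ra: "r a = c"
  shows "((\<lambda>x. f x * r x) has_derivative (\<lambda>v. f' v * c)) (at a within S)"
proof -
  have bl: "bounded_linear f'"
    using f by (rule has_derivative_bounded_linear)
  obtain K where K: "\<And>v. norm (f' v) \<le> norm v * K"
    using bounded_linear.bounded[OF bl] by blast
  let ?E = "\<lambda>x. norm (f x - f a - f' (x - a)) / norm (x - a)"
  have E: "(?E \<longlongrightarrow> 0) (at a within S)"
    using f unfolding has_derivative_iff_norm by simp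
  have lim: "((\<lambda>x. ?E x * norm (r x) + \<bar>K\<bar> * norm (r x - c)) \<longlongrightarrow> 0 * norm c + \<bar>K\<bar> * norm (c - c)) (at a within S)"
    by (intro tendsto_intros E r)
  have "((\<lambda>x. norm (f x * r x - f a * r a - f' (x - a) * c) / norm (x - a)) \<longlongrightarrow> 0) (at a within S)"
  proof (rule tendsto_0_le[OF _ always_eventually, where K = 1])
    show "((\<lambda>x. ?E x * norm (r x) + \<bar>K\<bar> * norm (r x - c)) \<longlongrightarrow> 0) (at a within S)"
      using lim by simp
    show "\<forall>x. norm (norm (f x * r x - f a * r a - f' (x - a) * c) / norm (x - a))
        \<le> norm (?E x * norm (r x) + \<bar>K\<bar> * norm (r x - c)) * 1"
    proof
      fix x
      have "f x * r x - f a * r a - f' (x - a) * c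
          = (f x - f a - f' (x - a)) * r x + f' (x - a) * (r x - c)"
        by (simp add: f0 algebra_simps)
      also have "norm \<dots> \<le> norm (f x - f a - f' (x - a)) * norm (r x) + norm (f' (x - a)) * norm (r x - c)"
        by (intro order_trans[OF norm_triangle_ineq] add_mono norm_mult_ineq)
      also have "\<dots> \<le> norm (f x - f a - f' (x - a)) * norm (r x) + (norm (x - a) * \<bar>K\<bar>) * norm (r x - c)"
        by (intro add_left_mono mult_right_mono order_trans[OF K] mult_left_mono) auto
      finally have "norm (f x * r x - f a * r a - f' (x - a) * c) / norm (x - a)
          \<le> (norm (f x - f a - f' (x - a)) * norm (r x) + (norm (x - a) * \<bar>K\<bar>) * norm (r x - c)) / norm (x - a)"
        by (rule divide_right_mono) simp
      also have "\<dots> \<le> ?E x * norm (r x) + \<bar>K\<bar> * norm (r x - c)"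
        by (cases "x = a") (simp_all add: add_divide_distrib)
      finally show "norm (norm (f x * r x - f a * r a - f' (x - a) * c) / norm (x - a))
        \<le> norm (?E x * norm (r x) + \<bar>K\<bar> * norm (r x - c)) * 1"
        by simp
    qed
  qed
  then show ?thesis
    unfolding has_derivative_iff_norm
    using bounded_linear_compose[OF bounded_linear_mult_left bl] by auto
qed

section \<open>The discriminant as a function of the list of eigenvalues\<close>

fun discr_list :: "complex list \<Rightarrow> complex" where
  "discr_list [] = 1"
| "discr_list (x # xs) = (\<Prod>y\<leftarrow>xs. (y - x)\<^sup>2) * discr_list xs"

lemma finite_index_pairs: "finite {(l, j). l < j \<and> j < (n::nat)}"
  by (rule finite_subset[of _ "{..<n} \<times> {..<n}"]) auto

lemma prod_pairs_eq_discr_list: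
  "(\<Prod>(l, j) \<in> {(l, j). l < j \<and> j < length es}. (es ! j - es ! l)\<^sup>2) = discr_list es"
proof (induction es)
  case Nil
  then show ?case by simp
next
  case (Cons e es)
  let ?I = "\<lambda>n::nat. {(l, j). l < j \<and> j < n}"
  have split: "?I (length (e # es)) = (\<lambda>j. (0, Suc j)) ` {..<length es}
      \<union> (\<lambda>(l, j). (Suc l, Suc j)) ` ?I (length es)" (is "_ = ?A \<union> ?B")
  proof (intro equalityI subsetI; clarify)
    fix l j assume "l < j" "j < length (e # es)" "(l, j) \<notin> ?B"
    then show "(l, j) \<in> ?A"
      by (cases l; cases j) (auto simp: image_iff)
  qed auto
  have "(\<Prod>(l, j) \<in> ?I (length (e # es)). ((e # es) ! j - (e # es) ! l)\<^sup>2)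
      = (\<Prod>(l, j) \<in> ?A. ((e # es) ! j - (e # es) ! l)\<^sup>2) * (\<Prod>(l, j) \<in> ?B. ((e # es) ! j - (e # es) ! l)\<^sup>2)"
    unfolding split by (rule prod.union_disjoint) (auto simp: finite_index_pairs)
  also have "(\<Prod>(l, j) \<in> ?A. ((e # es) ! j - (e # es) ! l)\<^sup>2) = (\<Prod>j<length es. (es ! j - e)\<^sup>2)"
    by (subst prod.reindex) (auto simp: inj_on_def)
  also have "\<dots> = (\<Prod>y\<leftarrow>es. (y - e)\<^sup>2)"
    by (simp add: prod.list_conv_set_nth atLeast0LessThan)
  also have "(\<Prod>(l, j) \<in> ?B. ((e # es) ! j - (e # es) ! l)\<^sup>2) = discr_list es"
    by (subst prod.reindex) (auto simp: inj_on_def Cons.IH[symmetric] intro!: prod.cong)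
  finally show ?case
    by simp
qed

text \<open>
  Moving an entry to the front changes only the sign of differences, and these occur squared.
\<close>

lemma discr_list_remove1:
  "x \<in> set xs \<Longrightarrow> discr_list xs = discr_list (x # remove1 x xs)"
proof (induction xs)
  case (Cons y xs)
  show ?case
  proof (cases "x = y")
    case False
    with Cons have x: "x \<in> set xs" and IH: "discr_list xs = discr_list (x # remove1 x xs)"
      by auto
    have "(\<Prod>z\<leftarrow>xs. (z - y)\<^sup>2) = (x - y)\<^sup>2 * (\<Prod>z\<leftarrow>remove1 x xs. (z - y)\<^sup>2)"
      using prod_list_map_remove1[OF x] .
    with False IH show ?thesis
      by (simp add: power2_commute[of x y])
  qed simp
qed simp

lemma discr_list_cong_mset:
  "mset xs = mset ys \<Longrightarrow> discr_list xs = discr_list ys"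
proof (induction xs arbitrary: ys)
  case (Cons x xs)
  then have x: "x \<in> set ys"
    using mset_eq_setD[OF Cons.prems] by auto
  have m: "mset xs = mset (remove1 x ys)"
    by (simp flip: Cons.prems)
  have "(\<Prod>y\<leftarrow>xs. (y - x)\<^sup>2) = (\<Prod>y\<leftarrow>remove1 x ys. (y - x)\<^sup>2)"
    using m by (simp flip: prod_mset_prod_list)
  then show ?case
    using Cons.IH[OF m] discr_list_remove1[OF x] by simp
qed simp

lemma linear_factors_unique:
  fixes xs ys :: "'a::idom list"
  shows "(\<Prod>e\<leftarrow>xs. [:- e, 1:]) = (\<Prod>e\<leftarrow>ys. [:- e, 1:]) \<Longrightarrow> mset xs = mset ys"
proof (induction xs arbitrary: ys)
  case Nil
  then have "degree (\<Prod>e\<leftarrow>ys. [:- e, 1:]) = 0"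
    by (simp flip: Nil)
  then show ?case
    using degree_linear_factors[of uminus ys] by simp
next
  case (Cons x xs)
  have "poly (\<Prod>e\<leftarrow>ys. [:- e, 1:]) x = 0"
    by (simp flip: Cons.prems)
  then have x: "x \<in> set ys"
    by (auto simp: poly_prod_list prod_list_zero_iff)
  have "[:- x, 1:] * (\<Prod>e\<leftarrow>xs. [:- e, 1:]) = [:- x, 1:] * (\<Prod>e\<leftarrow>remove1 x ys. [:- e, 1:])"
    using Cons.prems prod_list_map_remove1[OF x, of "\<lambda>e. [:- e, 1:]"] by simp
  then have "mset xs = mset (remove1 x ys)"
    by (intro Cons.IH) (simp only: mult_cancel_left, simp)
  then show ?case
    using x by simp
qed

lemma discr_eq:
  assumes "eigenvalue_list B es"
  shows "discr B = discr_list es"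
proof -
  have "eigenvalue_list B (SOME es. eigenvalue_list B es)"
    using assms by (rule someI)
  then have "mset (SOME es. eigenvalue_list B es) = mset es"
    using assms unfolding eigenvalue_list_def by (intro linear_factors_unique) simp
  then show ?thesis
    unfolding discr_def Let_def prod_pairs_eq_discr_list by (rule discr_list_cong_mset)
qed

section \<open>Simple eigenvalues and their eigenvectors\<close>

unbundle no vec_syntax

text \<open>
  A continuous simple root of a continuously differentiable family of functions inherits its smoothness.
  For fixed \<open>x\<close> put \<open>t = l x\<close>; then \<open>l y = t - G (y, t) / q y t\<close> for \<open>y\<close> near \<open>x\<close>. The
  numerator is differentiable in \<open>y\<close> and vanishes at \<open>y = x\<close>, so the quotient is differentiable there
  although the denominator is merely continuous. The resulting derivative is the usual
  \<open>- \<partial>\<^sub>x G / \<partial>\<^sub>t G\<close>, which is continuous because \<open>l\<close> is.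
\<close>

lemma C1_on_simple_root:
  fixes G :: "'a::euclidean_space \<times> real \<Rightarrow> complex" and l :: "'a \<Rightarrow> real"
  assumes G: "C1_on (S \<times> UNIV) G"
    and factor: "\<And>x t. x \<in> S \<Longrightarrow> G (x, t) = of_real (t - l x) * q x t"
    and l: "continuous_on S l"
    and q: "\<And>t. continuous_on S (\<lambda>x. q x t)" "continuous_on S (\<lambda>x. q x (l x))"
    and nz: "\<And>x. x \<in> S \<Longrightarrow> q x (l x) \<noteq> 0"
  shows "C1_on S l"
proof -
  obtain D where D: "\<And>p. p \<in> S \<times> UNIV \<Longrightarrow> (G has_derivative D p) (at p within S \<times> UNIV)"
    and c: "\<And>v. continuous_on (S \<times> UNIV) (\<lambda>p. D p v)"
    by (rule C1_onE[OF G]) blast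
  let ?E = "\<lambda>x v. - Re (D (x, l x) (v, 0) * inverse (q x (l x)))"
  show ?thesis
  proof (rule C1_onI[where D = ?E])
    fix x assume x: "x \<in> S"
    let ?t = "l x"
    have "((\<lambda>y. (y, ?t)) has_derivative (\<lambda>v. (v, 0))) (at x within S)"
      by (auto intro!: derivative_eq_intros)
    moreover have "(G has_derivative D (x, ?t)) (at (x, ?t) within (\<lambda>y. (y, ?t)) ` S)"
      using x by (intro has_derivative_subset[OF D]) auto
    ultimately have G': "((\<lambda>y. G (y, ?t)) has_derivative (\<lambda>v. D (x, ?t) (v, 0))) (at x within S)"
      using has_derivative_in_compose[of "\<lambda>y. (y, ?t)" "\<lambda>v. (v, 0)" x S G "D (x, ?t)"] by simp
    have lim: "((\<lambda>y. q y ?t) \<longlongrightarrow> q x ?t) (at x within S)"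
      using q(1) x by (simp add: continuous_on)
    have "((\<lambda>y. G (y, ?t) * inverse (q y ?t)) has_derivative
        (\<lambda>v. D (x, ?t) (v, 0) * inverse (q x ?t))) (at x within S)"
      using x by (intro has_derivative_mult_continuous_zero[OF G'] tendsto_inverse lim nz) (simp_all add: factor)
    from has_derivative_diff[OF has_derivative_const bounded_linear.has_derivative[OF bounded_linear_Re this]]
    have "((\<lambda>y. ?t - Re (G (y, ?t) * inverse (q y ?t))) has_derivative ?E x) (at x within S)"
      by (simp only: diff_0)
    moreover have l_eq: "?t - Re (G (y, ?t) * inverse (q y ?t)) = l y" if "y \<in> S" "q y ?t \<noteq> 0" for y
      unfolding factor[OF that(1)] mult.assoc right_inverse[OF that(2)] by simp
    moreover have "\<forall>\<^sub>F y in at x within S. ?t - Re (G (y, ?t) * inverse (q y ?t)) = l y"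
    proof -
      have "\<forall>\<^sub>F y in at x within S. q y ?t \<noteq> 0"
        using lim nz[OF x] by (rule tendsto_imp_eventually_ne)
      moreover have "\<forall>\<^sub>F y in at x within S. y \<in> S"
        unfolding eventually_at_topological by blast
      ultimately show ?thesis
        by eventually_elim (rule l_eq)
    qed
    ultimately show "(l has_derivative ?E x) (at x within S)"
      using has_derivative_transform_eventually l_eq[OF x nz[OF x]] x by blast
  next
    fix v
    have "continuous_on S (\<lambda>x. D (x, l x) (v, 0))"
      by (rule continuous_on_compose2[OF c]) (auto intro!: continuous_intros l)
    then show "continuous_on S (\<lambda>x. ?E x v)"
      using nz by (intro continuous_intros q) auto
  qed
qed

lemma C1_mat_on_subset: "C1_mat_on m n S A \<Longrightarrow> T \<subseteq> S \<Longrightarrow> C1_mat_on m n T A"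
  unfolding C1_mat_on_def by (meson C1_on_subset subsetD)

lemma C1_on_det:
  fixes A :: "'a::euclidean_space \<Rightarrow> complex mat"
  assumes "C1_mat_on n n S A"
  shows "C1_on S (\<lambda>x. Determinant.det (A x))"
proof (rule C1_on_cong)
  show "C1_on S (\<lambda>x. \<Sum>p \<in> {p. p permutes {0..<n}}. signof p * (\<Prod>i = 0..<n. A x $$ (i, p i)))"
    using assms permutes_in_image unfolding C1_mat_on_def
    by (intro C1_on_intros) fastforce
  show "(\<Sum>p \<in> {p. p permutes {0..<n}}. signof p * (\<Prod>i = 0..<n. A x $$ (i, p i))) = Determinant.det (A x)"
    if "x \<in> S" for x
    using det_def'[of "A x" n] assms that unfolding C1_mat_on_def by simp
qed

lemma C1_mat_on_adj_mat:
  fixes A :: "'a::euclidean_space \<Rightarrow> complex mat"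
  assumes A: "C1_mat_on n n S A"
  shows "C1_mat_on n n S (\<lambda>x. adj_mat (A x))"
proof -
  have carr: "A x \<in> carrier_mat n n" if "x \<in> S" for x
    using A that unfolding C1_mat_on_def by blast
  have "C1_on S (\<lambda>x. adj_mat (A x) $$ (i, j))" if ij: "i < n" "j < n" for i j
  proof (rule C1_on_cong)
    have "C1_mat_on (n - 1) (n - 1) S (\<lambda>x. mat_delete (A x) j i)"
      unfolding C1_mat_on_def
    proof (intro conjI ballI allI impI)
      show "mat_delete (A x) j i \<in> carrier_mat (n - 1) (n - 1)" if "x \<in> S" for x
        using carr[OF that] by (rule mat_delete_carrier)
      show "C1_on S (\<lambda>x. mat_delete (A x) j i $$ (k, l))" if kl: "k < n - 1" "l < n - 1" for k l
      proof (rule C1_on_cong)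
        show "C1_on S (\<lambda>x. A x $$ (if k < j then k else Suc k, if l < i then l else Suc l))"
          using A kl unfolding C1_mat_on_def by auto
        show "A x $$ (if k < j then k else Suc k, if l < i then l else Suc l) = mat_delete (A x) j i $$ (k, l)"
          if "x \<in> S" for x
          using carr[OF that] kl unfolding mat_delete_def by auto
      qed
    qed
    from C1_on_det[OF this] show "C1_on S (\<lambda>x. (- 1) ^ (j + i) * Determinant.det (mat_delete (A x) j i))"
      by (intro C1_on_intros)
    show "(- 1) ^ (j + i) * Determinant.det (mat_delete (A x) j i) = adj_mat (A x) $$ (i, j)" if "x \<in> S" for x
      using carr[OF that] ij unfolding adj_mat_def cofactor_def by auto
  qed
  then show ?thesis
    using carr adj_mat(1) unfolding C1_mat_on_def by blast
qed

lemma C1_mat_on_char_matrix: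
  fixes A :: "'a::euclidean_space \<Rightarrow> complex mat"
  assumes A: "C1_mat_on n n S A" and f: "C1_on S f"
  shows "C1_mat_on n n S (\<lambda>x. - char_matrix (A x) (f x))"
  unfolding C1_mat_on_def
proof (intro conjI ballI allI impI)
  show "- char_matrix (A x) (f x) \<in> carrier_mat n n" if "x \<in> S" for x
    using A that unfolding C1_mat_on_def by auto
  show "C1_on S (\<lambda>x. (- char_matrix (A x) (f x)) $$ (i, j))" if ij: "i < n" "j < n" for i j
  proof (rule C1_on_cong)
    show "C1_on S (\<lambda>x. f x * (if i = j then 1 else 0) - A x $$ (i, j))"
      using A f ij unfolding C1_mat_on_def by (intro C1_on_intros) auto
    show "f x * (if i = j then 1 else 0) - A x $$ (i, j) = (- char_matrix (A x) (f x)) $$ (i, j)"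
      if "x \<in> S" for x
    proof -
      have "A x \<in> carrier_mat n n"
        using A that unfolding C1_mat_on_def by blast
      then show ?thesis
        using ij unfolding char_matrix_def by auto
    qed
  qed
qed

text \<open>
  Instance of the previous root lemma with \<open>G (x, t) = det (t I - A x)\<close>, whose cofactor at the root
  \<open>l x\<close> is the product of the differences to the other eigenvalues.
\<close>

lemma C1_on_simple_eigenvalue:
  fixes A :: "'a::euclidean_space \<Rightarrow> complex mat" and l :: "'a \<Rightarrow> real"
  assumes A: "C1_mat_on n n S A"
    and char: "\<And>x. x \<in> S \<Longrightarrow>
      char_poly (A x) = [:- of_real (l x), 1:] * (\<Prod>k\<in>K. [:- of_real (\<mu> k x), 1:])"
    and l: "continuous_on S l" and \<mu>: "\<And>k. k \<in> K \<Longrightarrow> continuous_on S (\<mu> k)"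
    and simple: "\<And>x k. x \<in> S \<Longrightarrow> k \<in> K \<Longrightarrow> \<mu> k x \<noteq> l x"
    and K: "finite K"
  shows "C1_on S l"
proof (rule C1_on_simple_root)
  let ?G = "\<lambda>p. Determinant.det (- char_matrix (A (fst p)) (of_real (snd p)))"
  show "C1_on (S \<times> UNIV) ?G"
  proof (intro C1_on_det C1_mat_on_char_matrix C1_on_of_real C1_on_snd)
    show "C1_mat_on n n (S \<times> (UNIV :: real set)) (\<lambda>p. A (fst p))"
      unfolding C1_mat_on_def
    proof (intro conjI ballI allI impI)
      show "A (fst p) \<in> carrier_mat n n" if "p \<in> S \<times> UNIV" for p :: "'a \<times> real"
        using A that unfolding C1_mat_on_def by auto
      show "C1_on (S \<times> (UNIV :: real set)) (\<lambda>p. A (fst p) $$ (i, j))" if "i < n" "j < n" for i j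
      proof -
        have "C1_on S (\<lambda>x. A x $$ (i, j))"
          using A that unfolding C1_mat_on_def by blast
        from C1_on_fst[OF this] show ?thesis .
      qed
    qed
  qed
  show "?G (x, t) = of_real (t - l x) * of_real (\<Prod>k\<in>K. t - \<mu> k x)" if x: "x \<in> S" for x t
  proof -
    have "A x \<in> carrier_mat n n"
      using A x unfolding C1_mat_on_def by blast
    from char_poly_matrix[OF this, symmetric, of "of_real t"] show ?thesis
      by (simp add: char[OF x] poly_prod algebra_simps)
  qed
  show "continuous_on S (\<lambda>x. complex_of_real (\<Prod>k\<in>K. t - \<mu> k x))" for t
    by (intro continuous_intros \<mu>)
  show "continuous_on S (\<lambda>x. complex_of_real (\<Prod>k\<in>K. l x - \<mu> k x))"
    by (intro continuous_intros \<mu> l)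
  show "complex_of_real (\<Prod>k\<in>K. l x - \<mu> k x) \<noteq> 0" if "x \<in> S" for x
    using simple[OF that] K by force
qed (fact l)

text \<open>
  Vectors that vary with a parameter are represented as plain functions on indices below \<open>n\<close>: smoothness
  can then be stated entry by entry, and sums and scalar multiples need no dimension side conditions.
\<close>

definition mat_app :: "nat \<Rightarrow> complex mat \<Rightarrow> (nat \<Rightarrow> complex) \<Rightarrow> nat \<Rightarrow> complex" where
  "mat_app n M v i = (\<Sum>k<n. M $$ (i, k) * v k)"

lemma mat_app_eq_mult_mat_vec:
  assumes "M \<in> carrier_mat n n" "v \<in> carrier_vec n" "i < n"
  shows "(M *\<^sub>v v) $ i = mat_app n M (\<lambda>k. v $ k) i"
  using assms by (auto simp: mat_app_def scalar_prod_def atLeast0LessThan intro!: sum.cong)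

lemma char_matrix_mult_vec:
  assumes A: "(A :: complex mat) \<in> carrier_mat n n" and v: "v \<in> carrier_vec n" and i: "i < n"
  shows "((- char_matrix A x) *\<^sub>v v) $ i = x * v $ i - mat_app n A (\<lambda>k. v $ k) i"
proof -
  have "((- char_matrix A x) *\<^sub>v v) $ i = (\<Sum>k<n. (- char_matrix A x) $$ (i, k) * v $ k)"
    using A v i by (subst mat_app_eq_mult_mat_vec) (auto simp: mat_app_def)
  also have "\<dots> = (\<Sum>k<n. (if k = i then x * v $ k else 0) - A $$ (i, k) * v $ k)"
    using A i by (intro sum.cong) (auto simp: char_matrix_def algebra_simps)
  finally show ?thesis
    using i by (simp add: sum_subtractf mat_app_def)
qed

lemma smult_one_mult_vec:
  assumes "u \<in> carrier_vec n"
  shows "(d \<cdot>\<^sub>m 1\<^sub>m n) *\<^sub>v u = d \<cdot>\<^sub>v (u :: complex Matrix.vec)"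
  using assms by (intro Matrix.eq_vecI) auto

text \<open>
  For \<open>M = x I - A\<close> and an eigenvector \<open>u\<close> to \<open>c\<close>, evaluating \<open>adj M (M u)\<close> in two ways gives
  \<open>(x - c) adj M u = det M u = (x - c) q x u\<close>. One may cancel \<open>x - c\<close> for \<open>x \<noteq> c\<close> and then let \<open>x\<close>
  tend to \<open>c\<close>, because both sides are continuous in \<open>x\<close>.
\<close>

lemma adj_char_matrix_eigenvector:
  fixes A :: "complex mat"
  assumes A: "A \<in> carrier_mat n n" and u: "u \<in> carrier_vec n"
    and eig: "\<And>i. i < n \<Longrightarrow> mat_app n A (\<lambda>k. u $ k) i = c * u $ i"
    and char: "char_poly A = [:- c, 1:] * q" and i: "i < n"
  shows "(adj_mat (- char_matrix A c) *\<^sub>v u) $ i = poly q c * u $ i"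
proof -
  let ?M = "\<lambda>x. - char_matrix A x"
  let ?f = "\<lambda>x. (adj_mat (?M x) *\<^sub>v u) $ i" and ?g = "\<lambda>x. poly q x * u $ i"
  have M: "?M x \<in> carrier_mat n n" for x
    using A by simp
  have eq: "?f x = ?g x" if x: "x \<noteq> c" for x
  proof -
    have Mu: "?M x *\<^sub>v u = (x - c) \<cdot>\<^sub>v u"
    proof (rule Matrix.eq_vecI)
      show "(?M x *\<^sub>v u) $ k = ((x - c) \<cdot>\<^sub>v u) $ k" if "k < dim_vec ((x - c) \<cdot>\<^sub>v u)" for k
        using that u by (subst char_matrix_mult_vec[OF A u]) (auto simp: eig algebra_simps)
    qed (use A u in \<open>simp add: char_matrix_def\<close>)
    have "(x - c) \<cdot>\<^sub>v (adj_mat (?M x) *\<^sub>v u) = adj_mat (?M x) *\<^sub>v (?M x *\<^sub>v u)"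
      unfolding Mu by (rule mult_mat_vec[OF adj_mat(1)[OF M] u, symmetric])
    also have "\<dots> = (adj_mat (?M x) * ?M x) *\<^sub>v u"
      by (rule assoc_mult_mat_vec[OF adj_mat(1)[OF M] M u, symmetric])
    also have "\<dots> = Determinant.det (?M x) \<cdot>\<^sub>v u"
      using u by (subst adj_mat(3)[OF M]) (rule smult_one_mult_vec)
    finally have "((x - c) \<cdot>\<^sub>v (adj_mat (?M x) *\<^sub>v u)) $ i = (Determinant.det (?M x) \<cdot>\<^sub>v u) $ i"
      by simp
    then have "(x - c) * ?f x = Determinant.det (?M x) * u $ i"
      using adj_mat(1)[OF M[of x]] u i by simp
    also have "Determinant.det (?M x) = (x - c) * poly q x"
      using char_poly_matrix[OF A, of x] by (simp add: char algebra_simps)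
    finally show ?thesis
      using x by simp
  qed
  have "C1_mat_on n n UNIV (\<lambda>x. adj_mat (?M x))"
    using A by (intro C1_mat_on_adj_mat C1_mat_on_char_matrix C1_on_ident)
      (auto simp: C1_mat_on_def intro: C1_on_const)
  then have "continuous_on UNIV (\<lambda>x. \<Sum>k<n. adj_mat (?M x) $$ (i, k) * u $ k)"
    using i unfolding C1_mat_on_def by (intro continuous_intros C1_on_imp_continuous_on) auto
  also have "(\<lambda>x. \<Sum>k<n. adj_mat (?M x) $$ (i, k) * u $ k) = ?f"
    using mat_app_eq_mult_mat_vec[OF adj_mat(1)[OF M] u i] by (simp add: mat_app_def)
  finally have "?f \<midarrow>c\<rightarrow> ?f c"
    by (simp add: continuous_on_def)
  moreover have "?g \<midarrow>c\<rightarrow> ?g c"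
    by (intro tendsto_intros)
  moreover have "(?f \<longlongrightarrow> ?g c) (at c) \<longleftrightarrow> (?g \<longlongrightarrow> ?g c) (at c)"
    by (intro filterlim_cong) (auto simp: eventually_at_filter eq)
  ultimately show ?thesis
    using tendsto_unique[OF at_neq_bot] by blast
qed

text \<open>
  Since \<open>(l I - A) adj (l I - A) = det (l I - A) I = 0\<close>, every vector of the form
  \<open>adj (l I - A) u\<close> is an eigenvector or zero, and for constant \<open>u\<close> it is as smooth as \<open>A\<close> and \<open>l\<close>. If
  \<open>u\<close> is an eigenvector of \<open>A a\<close>, then at \<open>a\<close> the result is a multiple of \<open>u\<close> with a factor that does
  not vanish for a simple eigenvalue.
\<close>

lemma C1_eigenvector:
  fixes A :: "'a::euclidean_space \<Rightarrow> complex mat" and l :: "'a \<Rightarrow> complex"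
  assumes A: "C1_mat_on n n S A" and l: "C1_on S l"
    and root: "\<And>x. x \<in> S \<Longrightarrow> poly (char_poly (A x)) (l x) = 0"
    and a: "a \<in> S" and simple: "char_poly (A a) = [:- l a, 1:] * q" "poly q (l a) \<noteq> 0"
  obtains w where "\<And>i. i < n \<Longrightarrow> C1_on S (\<lambda>x. w x i)"
    and "\<And>x i. x \<in> S \<Longrightarrow> i < n \<Longrightarrow> mat_app n (A x) (w x) i = l x * w x i"
    and "\<exists>i<n. w a i \<noteq> 0"
proof -
  let ?M = "\<lambda>x. - char_matrix (A x) (l x)"
  have carr: "A x \<in> carrier_mat n n" and M: "?M x \<in> carrier_mat n n" if "x \<in> S" for x
    using A that unfolding C1_mat_on_def by auto
  have det0: "Determinant.det (?M x) = 0" if "x \<in> S" for x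
    using char_poly_matrix[OF carr[OF that], of "l x"] root[OF that] by simp
  obtain u where u: "u \<in> carrier_vec n" "u \<noteq> 0\<^sub>v n" "?M a *\<^sub>v u = 0\<^sub>v n"
    using det0[OF a] det_0_iff_vec_prod_zero[OF M[OF a]] by blast
  have eig: "mat_app n (A a) (\<lambda>k. u $ k) i = l a * u $ i" if "i < n" for i
    using char_matrix_mult_vec[OF carr[OF a] u(1) that, of "l a"] u(3) that by simp
  let ?w = "\<lambda>x i. (adj_mat (?M x) *\<^sub>v u) $ i"
  have C1: "C1_mat_on n n S (\<lambda>x. adj_mat (?M x))"
    by (intro C1_mat_on_adj_mat C1_mat_on_char_matrix A l)
  show thesis
  proof (rule that)
    show "C1_on S (\<lambda>x. ?w x i)" if i: "i < n" for i
    proof (rule C1_on_cong)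
      show "C1_on S (\<lambda>x. \<Sum>k<n. adj_mat (?M x) $$ (i, k) * u $ k)"
        using C1 i unfolding C1_mat_on_def by (intro C1_on_intros) auto
      show "(\<Sum>k<n. adj_mat (?M x) $$ (i, k) * u $ k) = ?w x i" if "x \<in> S" for x
        using mat_app_eq_mult_mat_vec[OF adj_mat(1)[OF M[OF that]] u(1) i] by (simp add: mat_app_def)
    qed
    show "mat_app n (A x) (?w x) i = l x * ?w x i" if x: "x \<in> S" and i: "i < n" for x i
    proof -
      let ?v = "adj_mat (?M x) *\<^sub>v u"
      have v: "?v \<in> carrier_vec n"
        using adj_mat(1)[OF M[OF x]] u(1) by simp
      have "?M x *\<^sub>v ?v = (?M x * adj_mat (?M x)) *\<^sub>v u"
        by (rule assoc_mult_mat_vec[OF M[OF x] adj_mat(1)[OF M[OF x]] u(1), symmetric])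
      also have "\<dots> = 0\<^sub>v n"
        unfolding adj_mat(2)[OF M[OF x]] det0[OF x] smult_one_mult_vec[OF u(1)]
        using u(1) by auto
      finally show ?thesis
        using char_matrix_mult_vec[OF carr[OF x] v i, of "l x"] i by simp
    qed
    obtain i where "i < n" "u $ i \<noteq> 0"
      using u(1,2) by (metis Matrix.eq_vecI carrier_vecD index_zero_vec(1,2))
    then show "\<exists>i<n. ?w a i \<noteq> 0"
      using adj_char_matrix_eigenvector[OF carr[OF a] u(1) eig simple(1)] simple(2) by auto
  qed
qed

section \<open>Orthonormal frames\<close>

definition cip :: "nat \<Rightarrow> (nat \<Rightarrow> complex) \<Rightarrow> (nat \<Rightarrow> complex) \<Rightarrow> complex" where
  "cip n u v = (\<Sum>i<n. cnj (u i) * v i)"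

lemma cip_diff_right: "cip n u (\<lambda>i. v i - w i) = cip n u v - cip n u w"
  by (simp add: cip_def algebra_simps sum_subtractf)

lemma cip_scale_right: "cip n u (\<lambda>i. v i * c) = cip n u v * c"
  by (simp add: cip_def sum_distrib_right mult.assoc)

lemma cip_scale_left: "cip n (\<lambda>i. u i * c) v = cnj c * cip n u v"
  by (simp add: cip_def sum_distrib_left ac_simps)

lemma cip_sum_right: "cip n u (\<lambda>i. \<Sum>k\<in>K. f k i) = (\<Sum>k\<in>K. cip n u (f k))"
  unfolding cip_def sum_distrib_left by (rule sum.swap)

lemma cip_commute: "cip n v u = cnj (cip n u v)"
  by (simp add: cip_def ac_simps)

lemma cip_self: "cip n u u = of_real (\<Sum>i<n. (cmod (u i))\<^sup>2)"
  by (simp add: cip_def complex_norm_square mult.commute del: of_real_power)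

lemma cip_self_of_real_Re: "cip n u u = of_real (Re (cip n u u))"
  by (simp add: cip_self)

lemma cip_self_pos:
  assumes "i < n" "u i \<noteq> 0"
  shows "0 < Re (cip n u u)"
  unfolding cip_self Re_complex_of_real
  by (rule sum_pos2[of _ i]) (use assms in auto)

lemma cip_cong: "(\<And>i. i < n \<Longrightarrow> u i = u' i) \<Longrightarrow> (\<And>i. i < n \<Longrightarrow> v i = v' i) \<Longrightarrow> cip n u v = cip n u' v'"
  by (simp add: cip_def)

lemma mat_adjoint_index:
  fixes A :: "complex mat"
  assumes "A \<in> carrier_mat m n" "i < m" "k < n"
  shows "mat_adjoint A $$ (k, i) = cnj (A $$ (i, k))"
  using assms unfolding mat_adjoint_def by (simp add: mat_of_rows_index)

lemma mat_adjoint_carrier: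
  fixes A :: "complex mat"
  shows "A \<in> carrier_mat m n \<Longrightarrow> mat_adjoint A \<in> carrier_mat n m"
  unfolding mat_adjoint_def by auto

lemma cip_mat_app_hermitian:
  assumes "hermitian_mat n A"
  shows "cip n (mat_app n A u) v = cip n u (mat_app n A v)"
proof -
  have A: "A \<in> carrier_mat n n" and adj: "mat_adjoint A = A"
    using assms unfolding hermitian_mat_def by auto
  have entry: "cnj (A $$ (i, k)) = A $$ (k, i)" if "i < n" "k < n" for i k
    using mat_adjoint_index[OF A that] adj by simp
  have "cip n (mat_app n A u) v = (\<Sum>i<n. \<Sum>k<n. cnj (A $$ (i, k)) * cnj (u k) * v i)"
    by (simp add: cip_def mat_app_def sum_distrib_right)
  also have "\<dots> = (\<Sum>k<n. \<Sum>i<n. cnj (A $$ (i, k)) * cnj (u k) * v i)"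
    by (rule sum.swap)
  also have "\<dots> = cip n u (mat_app n A v)"
    by (auto simp: cip_def mat_app_def sum_distrib_left entry ac_simps intro!: sum.cong)
  finally show ?thesis .
qed

lemma eigenvectors_orthogonal:
  fixes a b :: real
  assumes A: "hermitian_mat n A"
    and u: "\<And>i. i < n \<Longrightarrow> mat_app n A u i = of_real a * u i"
    and v: "\<And>i. i < n \<Longrightarrow> mat_app n A v i = of_real b * v i"
    and ab: "a \<noteq> b"
  shows "cip n u v = 0"
proof -
  have "of_real a * cip n u v = cip n (mat_app n A u) v"
    using cip_scale_left[of n u "of_real a" v] cip_cong[of n "mat_app n A u" "\<lambda>i. u i * of_real a" v v] u
    by (simp add: mult.commute)
  also have "\<dots> = cip n u (mat_app n A v)"
    by (rule cip_mat_app_hermitian[OF A])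
  also have "\<dots> = of_real b * cip n u v"
    using cip_scale_right[of n u v "of_real b"] cip_cong[of n u u "mat_app n A v" "\<lambda>i. v i * of_real b"] v
    by (simp add: mult.commute)
  finally show ?thesis
    using ab by simp
qed

lemma C1_on_cip:
  fixes u v :: "'a::euclidean_space \<Rightarrow> nat \<Rightarrow> complex"
  assumes "\<And>i. i < n \<Longrightarrow> C1_on S (\<lambda>x. u x i)" "\<And>i. i < n \<Longrightarrow> C1_on S (\<lambda>x. v x i)"
  shows "C1_on S (\<lambda>x. cip n (u x) (v x))"
  unfolding cip_def by (intro C1_on_intros assms) auto

definition normalized :: "nat \<Rightarrow> (nat \<Rightarrow> complex) \<Rightarrow> nat \<Rightarrow> complex" where
  "normalized n u i = u i * of_real (inverse (sqrt (Re (cip n u u))))"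

lemma cip_normalized:
  assumes "0 < Re (cip n u u)"
  shows "cip n (normalized n u) (normalized n u) = 1"
proof -
  let ?r = "Re (cip n u u)"
  have "cip n (normalized n u) (normalized n u)
      = of_real (inverse (sqrt ?r)) * cip n u u * of_real (inverse (sqrt ?r))"
    unfolding normalized_def by (simp add: cip_scale_right cip_scale_left)
  also have "\<dots> = of_real (inverse (sqrt ?r) * ?r * inverse (sqrt ?r))"
    by (subst cip_self_of_real_Re) simp
  also have "inverse (sqrt ?r) * ?r * inverse (sqrt ?r) = 1"
    using assms by (simp add: field_simps)
  finally show ?thesis
    by simp
qed

lemma C1_on_normalized:
  fixes u :: "'a::euclidean_space \<Rightarrow> nat \<Rightarrow> complex"
  assumes "\<And>i. i < n \<Longrightarrow> C1_on S (\<lambda>x. u x i)" "\<And>x. x \<in> S \<Longrightarrow> 0 < Re (cip n (u x) (u x))" "i < n"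
  shows "C1_on S (\<lambda>x. normalized n (u x) i)"
  unfolding normalized_def
  by (intro C1_on_mult C1_on_of_real C1_on_inverse_sqrt C1_on_Re C1_on_cip assms)

lemma open_norm_positive:
  fixes u :: "'a::euclidean_space \<Rightarrow> nat \<Rightarrow> complex"
  assumes "open S" "\<And>i. i < n \<Longrightarrow> C1_on S (\<lambda>x. u x i)"
  shows "open {x \<in> S. 0 < Re (cip n (u x) (u x))}"
proof -
  have "continuous_on S (\<lambda>x. Re (cip n (u x) (u x)))"
    by (intro C1_on_imp_continuous_on C1_on_Re C1_on_cip assms)
  from continuous_open_preimage[OF this assms(1) open_greaterThan[of 0]] show ?thesis
    by (simp add: vimage_def Int_def)
qed

text \<open>
  Fewer than \<open>n\<close> orthogonality conditions form a singular \<open>n \<times> n\<close> system once they are padded with zero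
  rows.
\<close>

lemma exists_unit_vector_orthogonal:
  assumes m: "m < n"
  obtains u where "\<And>k. k < m \<Longrightarrow> cip n (e k) u = 0" and "cip n u u = 1"
proof -
  let ?M = "Matrix.mat n n (\<lambda>(r, c). if r < m then cnj (e r c) else 0)"
  have M: "?M \<in> carrier_mat n n"
    by simp
  have "(\<Prod>i = 0..<n. ?M $$ (i, p i)) = 0" if "p permutes {0..<n}" for p
  proof (rule prod_zero)
    have "p m < n"
      using permutes_in_image[OF that, of m] m by simp
    then show "\<exists>i\<in>{0..<n}. ?M $$ (i, p i) = 0"
      using m by (intro bexI[of _ m]) auto
  qed simp
  then have "Determinant.det ?M = 0"
    unfolding det_def'[OF M] by (intro sum.neutral) auto
  then obtain v where v: "v \<in> carrier_vec n" "v \<noteq> 0\<^sub>v n" "?M *\<^sub>v v = 0\<^sub>v n"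
    using det_0_iff_vec_prod_zero[OF M] by blast
  let ?u = "\<lambda>i. v $ i"
  obtain i where i: "i < n" "?u i \<noteq> 0"
    using v(1,2) by (metis Matrix.eq_vecI carrier_vecD index_zero_vec(1,2))
  have orth: "cip n (e k) ?u = 0" if "k < m" for k
  proof -
    have "cip n (e k) ?u = mat_app n ?M ?u k"
      using that m by (auto simp: cip_def mat_app_def intro!: sum.cong)
    also have "\<dots> = (?M *\<^sub>v v) $ k"
      by (rule mat_app_eq_mult_mat_vec[OF M v(1), symmetric]) (use that m in simp)
    finally show ?thesis
      using v(3) that m by simp
  qed
  show thesis
  proof (rule that)
    show "cip n (normalized n ?u) (normalized n ?u) = 1"
      using cip_normalized cip_self_pos[of i n ?u] i by blast
    show "cip n (e k) (normalized n ?u) = 0" if "k < m" for k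
      unfolding normalized_def cip_scale_right using orth[OF that] by simp
  qed
qed

definition C1_orthonormal_frame ::
    "nat \<Rightarrow> nat \<Rightarrow> 'a::euclidean_space set \<Rightarrow> (nat \<Rightarrow> 'a \<Rightarrow> nat \<Rightarrow> complex) \<Rightarrow> bool" where
  "C1_orthonormal_frame n m S e \<longleftrightarrow>
     (\<forall>k<m. \<forall>i<n. C1_on S (\<lambda>x. e k x i)) \<and>
     (\<forall>x\<in>S. \<forall>k<m. \<forall>l<m. cip n (e k x) (e l x) = (if k = l then 1 else 0))"

text \<open>
  One Gram-Schmidt step applied to a constant vector \<open>u\<close>. Choosing \<open>u\<close> as a unit vector orthogonal to
  the frame at \<open>a\<close> makes the projected vector equal to \<open>u\<close> at \<open>a\<close>, hence nonzero on a
  neighbourhood \<open>T\<close> of \<open>a\<close>.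
\<close>

lemma C1_orthonormal_frame_extend:
  assumes e: "C1_orthonormal_frame n m S e" and m: "m < n" and S: "open S" "a \<in> S"
  obtains T f where "open T" "T \<subseteq> S" "a \<in> T" "C1_orthonormal_frame n (Suc m) T (e(m := f))"
proof -
  have C1e: "C1_on S (\<lambda>x. e k x i)" if "k < m" "i < n" for k i
    using e that unfolding C1_orthonormal_frame_def by blast
  have orth: "cip n (e k x) (e l x) = (if k = l then 1 else 0)" if "x \<in> S" "k < m" "l < m" for x k l
    using e that unfolding C1_orthonormal_frame_def by blast
  \<comment> \<open>the orthogonality holds at the point \<open>a\<close> only, but \<open>u\<close> does not vary\<close>
  obtain u where u: "\<And>k. k < m \<Longrightarrow> cip n (e k a) u = 0" "cip n u u = 1"
    using exists_unit_vector_orthogonal[OF m, of "\<lambda>k. e k a"] by blast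
  define w where "w x i = u i - (\<Sum>k<m. e k x i * cip n (e k x) u)" for x i
  have C1w: "C1_on S (\<lambda>x. w x i)" if "i < n" for i
    unfolding w_def using that by (intro C1_on_intros C1_on_cip C1e) auto
  have ew: "cip n (e l x) (w x) = 0" if "x \<in> S" "l < m" for x l
  proof -
    have "cip n (e l x) (w x) = cip n (e l x) u - (\<Sum>k<m. cip n (e l x) (e k x) * cip n (e k x) u)"
      unfolding w_def cip_diff_right cip_sum_right cip_scale_right ..
    also have "(\<Sum>k<m. cip n (e l x) (e k x) * cip n (e k x) u)
        = (\<Sum>k<m. if k = l then cip n (e l x) u else 0)"
      using that orth by (intro sum.cong) auto
    finally show ?thesis
      using that by simp
  qed
  have "w a = u"
    using u(1) by (simp add: w_def fun_eq_iff)
  let ?T = "{x \<in> S. 0 < Re (cip n (w x) (w x))}"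
  let ?f = "\<lambda>x. normalized n (w x)"
  have ef: "cip n (e l x) (?f x) = 0" if "x \<in> ?T" "l < m" for x l
    using ew[of x l] that unfolding normalized_def cip_scale_right by simp
  have fe: "cip n (?f x) (e l x) = 0" if "x \<in> ?T" "l < m" for x l
    using ef[OF that] cip_commute[of n "?f x" "e l x"] by simp
  show thesis
  proof (rule that[of ?T ?f])
    show "open ?T"
      by (rule open_norm_positive[OF S(1) C1w])
    show "a \<in> ?T"
      using S(2) u(2) \<open>w a = u\<close> by simp
    show "C1_orthonormal_frame n (Suc m) ?T (e(m := ?f))"
      unfolding C1_orthonormal_frame_def
    proof (intro conjI allI impI ballI)
      fix k i assume k: "k < Suc m" and i: "i < n"
      show "C1_on ?T (\<lambda>x. (e(m := ?f)) k x i)"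
      proof (cases "k = m")
        case True
        then show ?thesis
          using i by (auto intro!: C1_on_normalized C1_on_subset[OF C1w])
      next
        case False
        then show ?thesis
          using k i by (auto intro!: C1_on_subset[OF C1e])
      qed
    next
      fix x k l assume x: "x \<in> ?T" and k: "k < Suc m" and l: "l < Suc m"
      then show "cip n ((e(m := ?f)) k x) ((e(m := ?f)) l x) = (if k = l then 1 else 0)"
        using ef[OF x] fe[OF x] orth[of x] cip_normalized[of n "w x"] by (auto simp: less_Suc_eq)
    qed
  qed auto
qed

section \<open>Local block Schur decompositions\<close>

lemma char_poly_four_block_diag:
  fixes B C :: "complex mat"
  assumes B: "B \<in> carrier_mat k k" and C: "C \<in> carrier_mat m m"
  shows "char_poly (four_block_mat B (0\<^sub>m k m) (0\<^sub>m m k) C) = char_poly B * char_poly C"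
proof -
  let ?A = "four_block_mat B (0\<^sub>m k m) (0\<^sub>m m k) C"
  have "char_poly_matrix ?A = four_block_mat (char_poly_matrix B) (0\<^sub>m k m) (0\<^sub>m m k) (char_poly_matrix C)"
    by (rule eq_matI, insert B C, auto simp: char_poly_matrix_def one_poly_def)
  then show ?thesis
    unfolding char_poly_def using B C
    by (simp add: det_four_block_mat_lower_left_zero[of _ k _ m])
qed

lemma char_poly_mat_diag:
  "char_poly (mat_diag m f :: complex mat) = (\<Prod>i<m. [:- f i, 1:])"
proof -
  have "char_poly (mat_diag m f) = (\<Prod>a\<leftarrow>diag_mat (mat_diag m f). [:- a, 1:])"
    by (rule char_poly_upper_triangular[OF mat_diag_dim]) (auto simp: mat_diag_def upper_triangular_def)
  also have "diag_mat (mat_diag m f) = map f [0..<m]"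
    by (auto simp: diag_mat_def mat_diag_def)
  finally show ?thesis
    by (simp add: prod.list_conv_set_nth atLeast0LessThan)
qed

text \<open>
  An orthonormal basis of which all but the first two vectors are eigenvectors puts a Hermitian matrix
  into block form. In a mixed entry, where exactly one of the two basis vectors belongs to the first two,
  the matrix may be moved by the Hermitian symmetry to the side of the eigenvector, so the entry vanishes
  by orthogonality.
\<close>

lemma block_schur_of_orthonormal_basis:
  fixes A :: "complex mat" and f :: "nat \<Rightarrow> nat \<Rightarrow> complex" and \<mu> :: "nat \<Rightarrow> real"
  assumes A: "hermitian_mat n A" and n: "n = m + 2"
    and orth: "\<And>k l. k < n \<Longrightarrow> l < n \<Longrightarrow> cip n (f k) (f l) = (if k = l then 1 else 0)"
    and eig: "\<And>k i. k < m \<Longrightarrow> i < n \<Longrightarrow> mat_app n A (f (k + 2)) i = of_real (\<mu> k) * f (k + 2) i"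
  defines "U \<equiv> Matrix.mat n n (\<lambda>(i, k). f k i)"
    and "P \<equiv> Matrix.mat 2 2 (\<lambda>(k, l). cip n (f k) (mat_app n A (f l)))"
    and "D \<equiv> mat_diag m (\<lambda>i. complex_of_real (\<mu> i))"
  shows "unitary_mat n U" "hermitian_mat 2 P"
    and "A = U * four_block_mat P (0\<^sub>m 2 m) (0\<^sub>m m 2) D * mat_adjoint U"
    and "char_poly A = char_poly P * (\<Prod>i<m. [:- of_real (\<mu> i), 1:])"
proof -
  let ?V = "mat_adjoint U" and ?B = "four_block_mat P (0\<^sub>m 2 m) (0\<^sub>m m 2) D"
  have Ac: "A \<in> carrier_mat n n"
    using A unfolding hermitian_mat_def by blast
  have U: "U \<in> carrier_mat n n"
    unfolding U_def by simp
  have V: "?V \<in> carrier_mat n n"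
    using U by (rule mat_adjoint_carrier)
  have Pc: "P \<in> carrier_mat 2 2" and Dc: "D \<in> carrier_mat m m"
    unfolding P_def D_def by simp_all
  have Bc: "?B \<in> carrier_mat n n"
    using four_block_carrier_mat[OF Pc Dc] n by (simp add: add.commute)
  have V_mult: "(?V * X) $$ (k, l) = cip n (f k) (\<lambda>i. X $$ (i, l))"
    if X: "X \<in> carrier_mat n n" and kl: "k < n" "l < n" for X k l
  proof -
    have "(?V * X) $$ (k, l) = (\<Sum>i<n. ?V $$ (k, i) * X $$ (i, l))"
      using V X kl by (simp add: scalar_prod_def atLeast0LessThan)
    then show ?thesis
      using mat_adjoint_index[OF U] kl by (simp add: cip_def U_def)
  qed
  have VU: "?V * U = 1\<^sub>m n"
  proof (rule eq_matI)
    show "(?V * U) $$ (k, l) = 1\<^sub>m n $$ (k, l)" if "k < dim_row (1\<^sub>m n)" "l < dim_col (1\<^sub>m n)" for k l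
    proof -
      have kl: "k < n" "l < n"
        using that by auto
      have "cip n (f k) (\<lambda>i. U $$ (i, l)) = cip n (f k) (f l)"
        using kl by (intro cip_cong) (simp_all add: U_def)
      then show ?thesis
        unfolding V_mult[OF U kl] using orth[OF kl] kl by simp
    qed
  qed (use U V in auto)
  have UV: "U * ?V = 1\<^sub>m n"
    by (rule mat_mult_left_right_inverse[OF V U VU])
  show "unitary_mat n U"
    unfolding unitary_mat_def using U VU UV by blast
  show "hermitian_mat 2 P"
    unfolding hermitian_mat_def
  proof (intro conjI eq_matI)
    show "mat_adjoint P $$ (k, l) = P $$ (k, l)" if "k < dim_row P" "l < dim_col P" for k l
    proof -
      have kl: "k < 2" "l < 2"
        using that Pc by auto
      have "cnj (cip n (f l) (mat_app n A (f k))) = cip n (f k) (mat_app n A (f l))"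
        using cip_commute[of n "mat_app n A (f k)" "f l"] cip_mat_app_hermitian[OF A, of "f k" "f l"] by simp
      then show ?thesis
        unfolding mat_adjoint_index[OF Pc kl(2,1)] using kl by (simp add: P_def)
    qed
  qed (use Pc mat_adjoint_carrier[OF Pc] in auto)
  have eig': "mat_app n A (f l) i = f l i * of_real (\<mu> (l - 2))" if "2 \<le> l" "l < n" "i < n" for l i
  proof -
    define k where "k = l - 2"
    have "l = k + 2"
      using that(1) by (simp add: k_def)
    then show ?thesis
      using eig[of k i] that n by (simp add: mult.commute)
  qed
  have VAU: "?V * (A * U) = ?B"
  proof (rule eq_matI)
    show "(?V * (A * U)) $$ (k, l) = ?B $$ (k, l)" if "k < dim_row ?B" "l < dim_col ?B" for k l
    proof -
      have kl: "k < n" "l < n"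
        using that Bc by auto
      have "(A * U) $$ (i, l) = mat_app n A (f l) i" if "i < n" for i
        using Ac U that kl by (simp add: scalar_prod_def mat_app_def atLeast0LessThan U_def)
      then have entry: "(?V * (A * U)) $$ (k, l) = cip n (f k) (mat_app n A (f l))"
        using Ac U kl by (simp add: V_mult cip_def)
      have eig_r: "cip n (f k) (mat_app n A (f l)) = of_real (\<mu> (l - 2)) * (if k = l then 1 else 0)" if "2 \<le> l"
      proof -
        have "cip n (f k) (mat_app n A (f l)) = cip n (f k) (\<lambda>i. f l i * of_real (\<mu> (l - 2)))"
          using eig' kl that by (intro cip_cong) auto
        then show ?thesis
          using orth[OF kl] by (simp add: cip_scale_right)
      qed
      have eig_l: "cip n (f k) (mat_app n A (f l)) = of_real (\<mu> (k - 2)) * (if k = l then 1 else 0)" if "2 \<le> k"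
      proof -
        have "cip n (mat_app n A (f k)) (f l) = cip n (\<lambda>i. f k i * of_real (\<mu> (k - 2))) (f l)"
          using eig' kl that by (intro cip_cong) auto
        then show ?thesis
          using orth[OF kl] by (simp add: cip_scale_left cip_mat_app_hermitian[OF A])
      qed
      have "?B $$ (k, l) = (if k < 2 then if l < 2 then P $$ (k, l) else 0
          else if l < 2 then 0 else D $$ (k - 2, l - 2))"
        using kl n Pc Dc by (simp add: index_mat_four_block)
      then show ?thesis
        unfolding entry using kl n eig_l eig_r by (auto simp: P_def D_def mat_diag_def)
    qed
  qed (use Ac U V Bc in auto)
  have "A = (U * ?V) * A * (U * ?V)"
    using Ac by (simp add: UV)
  also have "\<dots> = U * (?V * (A * U)) * ?V"
    using Ac U V by (simp add: assoc_mult_mat[of _ n n _ n _ n])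
  finally show A_eq: "A = U * ?B * ?V"
    unfolding VAU .
  have "similar_mat_wit A ?B U ?V"
    by (rule similar_mat_witI[OF UV VU A_eq Ac Bc U V])
  then have "similar_mat A ?B"
    unfolding similar_mat_def by blast
  then have "char_poly A = char_poly ?B"
    by (rule char_poly_similar)
  also have "\<dots> = char_poly P * char_poly D"
    by (rule char_poly_four_block_diag[OF Pc Dc])
  also have "char_poly D = (\<Prod>i<m. [:- of_real (\<mu> i), 1:])"
    unfolding D_def by (rule char_poly_mat_diag)
  finally show "char_poly A = char_poly P * (\<Prod>i<m. [:- of_real (\<mu> i), 1:])" .
qed

locale coalescing_eigenvalues =
  fixes n h :: nat
    and \<Omega> :: "(real ^ 3) set"
    and A :: "real ^ 3 \<Rightarrow> complex mat"
    and lam :: "nat \<Rightarrow> real ^ 3 \<Rightarrow> real"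
    and \<xi>0 :: "real ^ 3"
  assumes n_ge_2: "n \<ge> 2"
    and open_\<Omega>: "open \<Omega>"
    and C1_A: "C1_mat_on n n \<Omega> A"
    and hermitian_A: "\<And>\<xi>. \<xi> \<in> \<Omega> \<Longrightarrow> hermitian_mat n (A \<xi>)"
    and eigenvalues_A:
      "\<And>\<xi>. \<xi> \<in> \<Omega> \<Longrightarrow> eigenvalue_list (A \<xi>) (map (\<lambda>j. complex_of_real (lam j \<xi>)) [1..<n + 1])"
    and lam_ordered: "\<And>\<xi> j. \<xi> \<in> \<Omega> \<Longrightarrow> 1 \<le> j \<Longrightarrow> j < n \<Longrightarrow> lam j \<xi> \<ge> lam (j + 1) \<xi>"
    and lam_continuous: "\<And>j. 1 \<le> j \<Longrightarrow> j \<le> n \<Longrightarrow> continuous_on \<Omega> (lam j)"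
    and h_ge_1: "1 \<le> h" and h_le: "h \<le> n - 1"
    and \<xi>0_in: "\<xi>0 \<in> \<Omega>"
    and coalesce: "\<And>\<xi> j. \<xi> \<in> \<Omega> \<Longrightarrow> 1 \<le> j \<Longrightarrow> j < n \<Longrightarrow>
           lam j \<xi> = lam (j + 1) \<xi> \<longleftrightarrow> j = h \<and> \<xi> = \<xi>0"
begin

lemma lam_antimono:
  assumes "\<xi> \<in> \<Omega>" "1 \<le> i" "i \<le> j" "j \<le> n"
  shows "lam j \<xi> \<le> lam i \<xi>"
  using assms(3,4)
proof (induction j rule: dec_induct)
  case (step j)
  then show ?case
    using lam_ordered[OF assms(1), of j] assms(2) by simp
qed simp

text \<open>
  Equality of two eigenvalues forces equality of all those between them in the ordering, in particular of
  the first neighbouring pair and of the last one. Both of these must be the coalescing pair.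
\<close>

lemma lam_eq_imp:
  assumes \<xi>: "\<xi> \<in> \<Omega>" and ij: "1 \<le> i" "i < j" "j \<le> n" and eq: "lam i \<xi> = lam j \<xi>"
  shows "i = h \<and> j = h + 1 \<and> \<xi> = \<xi>0"
proof -
  have "lam j \<xi> \<le> lam (i + 1) \<xi>" "lam (i + 1) \<xi> \<le> lam i \<xi>"
    using ij by (auto intro!: lam_antimono \<xi>)
  then have "lam i \<xi> = lam (i + 1) \<xi>"
    using eq by simp
  moreover have "lam j \<xi> \<le> lam (j - 1) \<xi>" "lam (j - 1) \<xi> \<le> lam i \<xi>"
    using ij by (auto intro!: lam_antimono \<xi>)
  then have "lam (j - 1) \<xi> = lam (j - 1 + 1) \<xi>"
    using eq ij by simp
  ultimately show ?thesis
    using coalesce[OF \<xi>, of i] coalesce[OF \<xi>, of "j - 1"] ij by auto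
qed

lemma lam_simple:
  assumes "\<xi> \<in> \<Omega>" "j \<in> {1..n} - {h, h + 1}" "k \<in> {1..n}" "k \<noteq> j"
  shows "lam k \<xi> \<noteq> lam j \<xi>"
  using lam_eq_imp[OF assms(1), of k j] lam_eq_imp[OF assms(1), of j k] assms
  by (cases "k < j") auto

lemma char_poly_A:
  assumes "\<xi> \<in> \<Omega>"
  shows "char_poly (A \<xi>) = (\<Prod>j\<in>{1..n}. [:- of_real (lam j \<xi>), 1:])"
proof -
  have "char_poly (A \<xi>) = (\<Prod>j\<leftarrow>[1..<n + 1]. [:- of_real (lam j \<xi>), 1:])"
    using eigenvalues_A[OF assms] by (simp add: eigenvalue_list_def comp_def)
  also have "\<dots> = (\<Prod>j\<in>set [1..<n + 1]. [:- of_real (lam j \<xi>), 1:])"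
    by (rule prod.distinct_set_conv_list[symmetric]) simp
  also have "set [1..<n + 1] = {1..n}"
    by auto
  finally show ?thesis .
qed

lemma char_poly_A_split:
  assumes "\<xi> \<in> \<Omega>" "j \<in> {1..n}"
  shows "char_poly (A \<xi>) = [:- of_real (lam j \<xi>), 1:] * (\<Prod>k\<in>{1..n} - {j}. [:- of_real (lam k \<xi>), 1:])"
  unfolding char_poly_A[OF assms(1)] by (rule prod.remove) (use assms(2) in auto)

lemma C1_simple_lam:
  assumes j: "j \<in> {1..n} - {h, h + 1}"
  shows "C1_on \<Omega> (lam j)"
proof (rule C1_on_simple_eigenvalue[OF C1_A])
  show "char_poly (A \<xi>) = [:- of_real (lam j \<xi>), 1:] * (\<Prod>k\<in>{1..n} - {j}. [:- of_real (lam k \<xi>), 1:])"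
    if "\<xi> \<in> \<Omega>" for \<xi>
    using char_poly_A_split[OF that] j by blast
  show "lam k \<xi> \<noteq> lam j \<xi>" if "\<xi> \<in> \<Omega>" "k \<in> {1..n} - {j}" for \<xi> k
    using lam_simple[OF that(1) j] that(2) by blast
qed (use j lam_continuous in auto)

lemma C1_simple_eigenvector:
  assumes j: "j \<in> {1..n} - {h, h + 1}"
  obtains w where "\<And>i. i < n \<Longrightarrow> C1_on \<Omega> (\<lambda>\<xi>. w \<xi> i)"
    and "\<And>\<xi> i. \<xi> \<in> \<Omega> \<Longrightarrow> i < n \<Longrightarrow> mat_app n (A \<xi>) (w \<xi>) i = of_real (lam j \<xi>) * w \<xi> i"
    and "\<exists>i<n. w \<xi>0 i \<noteq> 0"
proof (rule C1_eigenvector[OF C1_A C1_on_of_real[OF C1_simple_lam[OF j]] _ \<xi>0_in])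
  have jn: "j \<in> {1..n}"
    using j by blast
  show "poly (char_poly (A \<xi>)) (of_real (lam j \<xi>)) = 0" if "\<xi> \<in> \<Omega>" for \<xi>
    unfolding char_poly_A_split[OF that jn] by simp
  show "char_poly (A \<xi>0) = [:- of_real (lam j \<xi>0), 1:] * (\<Prod>k\<in>{1..n} - {j}. [:- of_real (lam k \<xi>0), 1:])"
    by (rule char_poly_A_split[OF \<xi>0_in jn])
  show "poly (\<Prod>k\<in>{1..n} - {j}. [:- of_real (lam k \<xi>0), 1:]) (complex_of_real (lam j \<xi>0)) \<noteq> 0"
    using lam_simple[OF \<xi>0_in j] by (auto simp: poly_prod) force
qed (rule that, auto)

text \<open>
  The eigenvalue index that belongs to the diagonal position \<open>i\<close> of \<open>remaining_diag\<close>.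
\<close>

definition kept :: "nat \<Rightarrow> nat" where
  "kept i = (if i + 1 < h then i + 1 else i + 3)"

lemma kept_bij: "bij_betw kept {..<n - 2} ({1..n} - {h, h + 1})"
  by (rule bij_betwI[where g = "\<lambda>j. if j < h then j - 1 else j - 3"])
    (use n_ge_2 h_ge_1 h_le in \<open>auto simp: kept_def split: if_splits\<close>)

lemma kept_mem: "i < n - 2 \<Longrightarrow> kept i \<in> {1..n} - {h, h + 1}"
  using bij_betwE[OF kept_bij] by blast

lemma kept_inj: "i < n - 2 \<Longrightarrow> k < n - 2 \<Longrightarrow> i \<noteq> k \<Longrightarrow> kept i \<noteq> kept k"
  using kept_bij by (auto simp: bij_betw_def inj_on_def)

lemma remaining_diag_eq:
  "remaining_diag n h lam \<xi> = mat_diag (n - 2) (\<lambda>i. complex_of_real (lam (kept i) \<xi>))"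
  unfolding remaining_diag_def kept_def by (rule arg_cong[where f = "mat_diag (n - 2)"]) auto

lemma char_poly_A_kept:
  assumes "\<xi> \<in> \<Omega>"
  shows "char_poly (A \<xi>) = (\<Prod>e\<leftarrow>[complex_of_real (lam h \<xi>), complex_of_real (lam (h + 1) \<xi>)]. [:- e, 1:])
    * (\<Prod>i<n - 2. [:- of_real (lam (kept i) \<xi>), 1:])"
proof -
  let ?f = "\<lambda>j. [:- complex_of_real (lam j \<xi>), 1:]"
  have "char_poly (A \<xi>) = prod ?f {h, h + 1} * prod ?f ({1..n} - {h, h + 1})"
    unfolding char_poly_A[OF assms] using h_ge_1 h_le n_ge_2
    by (subst prod.subset_diff[of "{h, h + 1}"]) (auto simp: mult.commute)
  also have "prod ?f ({1..n} - {h, h + 1}) = (\<Prod>i<n - 2. ?f (kept i))"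
    by (rule prod.reindex_bij_betw[OF kept_bij, symmetric])
  finally show ?thesis
    by simp
qed

lemma C1_simple_frame:
  obtains S e where "open S" "S \<subseteq> \<Omega>" "\<xi>0 \<in> S" "C1_orthonormal_frame n (n - 2) S e"
    and "\<And>\<xi> k i. \<xi> \<in> S \<Longrightarrow> k < n - 2 \<Longrightarrow> i < n \<Longrightarrow>
      mat_app n (A \<xi>) (e k \<xi>) i = of_real (lam (kept k) \<xi>) * e k \<xi> i"
proof -
  have "\<forall>k\<in>{..<n - 2}. \<exists>w. (\<forall>i<n. C1_on \<Omega> (\<lambda>\<xi>. w \<xi> i)) \<and>
      (\<forall>\<xi>\<in>\<Omega>. \<forall>i<n. mat_app n (A \<xi>) (w \<xi>) i = of_real (lam (kept k) \<xi>) * w \<xi> i) \<and>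
      (\<exists>i<n. w \<xi>0 i \<noteq> 0)"
  proof
    fix k assume "k \<in> {..<n - 2}"
    then obtain w where "\<And>i. i < n \<Longrightarrow> C1_on \<Omega> (\<lambda>\<xi>. w \<xi> i)"
      and "\<And>\<xi> i. \<xi> \<in> \<Omega> \<Longrightarrow> i < n \<Longrightarrow> mat_app n (A \<xi>) (w \<xi>) i = of_real (lam (kept k) \<xi>) * w \<xi> i"
      and "\<exists>i<n. w \<xi>0 i \<noteq> 0"
      using C1_simple_eigenvector[OF kept_mem] by (metis lessThan_iff)
    then show "\<exists>w. (\<forall>i<n. C1_on \<Omega> (\<lambda>\<xi>. w \<xi> i)) \<and>
      (\<forall>\<xi>\<in>\<Omega>. \<forall>i<n. mat_app n (A \<xi>) (w \<xi>) i = of_real (lam (kept k) \<xi>) * w \<xi> i) \<and>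
      (\<exists>i<n. w \<xi>0 i \<noteq> 0)"
      by blast
  qed
  from bchoice[OF this] obtain w where
    w: "\<forall>k\<in>{..<n - 2}. (\<forall>i<n. C1_on \<Omega> (\<lambda>\<xi>. w k \<xi> i)) \<and>
      (\<forall>\<xi>\<in>\<Omega>. \<forall>i<n. mat_app n (A \<xi>) (w k \<xi>) i = of_real (lam (kept k) \<xi>) * w k \<xi> i) \<and>
      (\<exists>i<n. w k \<xi>0 i \<noteq> 0)"
    by blast
  then have C1w: "\<And>k i. k < n - 2 \<Longrightarrow> i < n \<Longrightarrow> C1_on \<Omega> (\<lambda>\<xi>. w k \<xi> i)"
    and eig: "\<And>k \<xi> i. k < n - 2 \<Longrightarrow> \<xi> \<in> \<Omega> \<Longrightarrow> i < n \<Longrightarrow>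
      mat_app n (A \<xi>) (w k \<xi>) i = of_real (lam (kept k) \<xi>) * w k \<xi> i"
    and nz: "\<And>k. k < n - 2 \<Longrightarrow> \<exists>i<n. w k \<xi>0 i \<noteq> 0"
    by blast+
  let ?T = "\<lambda>k. {\<xi> \<in> \<Omega>. 0 < Re (cip n (w k \<xi>) (w k \<xi>))}"
  let ?S = "\<Omega> \<inter> (\<Inter>k<n - 2. ?T k)"
  let ?e = "\<lambda>k \<xi>. normalized n (w k \<xi>)"
  show thesis
  proof (rule that[of ?S ?e])
    have "open (\<Inter>k<n - 2. ?T k)"
      by (intro open_INT ballI open_norm_positive[OF open_\<Omega>] C1w) auto
    then show "open ?S"
      using open_\<Omega> by blast
    show "\<xi>0 \<in> ?S"
      using \<xi>0_in nz cip_self_pos by auto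
    show eigen: "mat_app n (A \<xi>) (?e k \<xi>) i = of_real (lam (kept k) \<xi>) * ?e k \<xi> i"
      if "\<xi> \<in> ?S" "k < n - 2" "i < n" for \<xi> k i
    proof -
      have "mat_app n (A \<xi>) (?e k \<xi>) i
          = mat_app n (A \<xi>) (w k \<xi>) i * of_real (inverse (sqrt (Re (cip n (w k \<xi>) (w k \<xi>)))))"
        by (simp add: mat_app_def normalized_def sum_distrib_right mult.assoc)
      then show ?thesis
        using eig[of k \<xi> i] that by (simp add: normalized_def)
    qed
    show "C1_orthonormal_frame n (n - 2) ?S ?e"
      unfolding C1_orthonormal_frame_def
    proof (intro conjI allI impI ballI)
      fix k i assume ki: "k < n - 2" "i < n"
      show "C1_on ?S (\<lambda>\<xi>. ?e k \<xi> i)"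
        by (rule C1_on_normalized) (use ki in \<open>auto intro: C1_on_subset[OF C1w]\<close>)
    next
      fix \<xi> k l assume \<xi>: "\<xi> \<in> ?S" and k: "k < n - 2" and l: "l < n - 2"
      show "cip n (?e k \<xi>) (?e l \<xi>) = (if k = l then 1 else 0)"
      proof (cases "k = l")
        case True
        then show ?thesis
          using \<xi> k by (auto intro: cip_normalized)
      next
        case False
        have "lam (kept k) \<xi> \<noteq> lam (kept l) \<xi>"
          using lam_simple[of \<xi> "kept l" "kept k"] kept_mem[OF k] kept_mem[OF l] kept_inj[OF k l False] \<xi> by blast
        then show ?thesis
          using eigenvectors_orthogonal[OF hermitian_A eigen[OF \<xi> k] eigen[OF \<xi> l]] \<xi> False by auto
      qed
    qed
  qed auto
qed

text \<open>
  The columns of \<open>U\<close> are the eigenvectors of the simple eigenvalues, preceded by two vectors that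
  complete them to an orthonormal basis. That the block \<open>P\<close> has the two coalescing eigenvalues follows by
  cancelling the factors of the simple ones from the characteristic polynomial.
\<close>

lemma C1_block_schur_exists:
  obtains R U P where "open R" "is_interval R" "R \<subseteq> \<Omega>" "\<xi>0 \<in> R" "C1_block_schur n h lam A R U P"
proof -
  obtain S e where S: "open S" "S \<subseteq> \<Omega>" "\<xi>0 \<in> S" and e: "C1_orthonormal_frame n (n - 2) S e"
    and eig: "\<And>\<xi> k i. \<xi> \<in> S \<Longrightarrow> k < n - 2 \<Longrightarrow> i < n \<Longrightarrow>
      mat_app n (A \<xi>) (e k \<xi>) i = of_real (lam (kept k) \<xi>) * e k \<xi> i"
    using C1_simple_frame by blast
  have n2: "n - 2 < n" "Suc (n - 2) < n" "Suc (Suc (n - 2)) = n"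
    using n_ge_2 by auto
  obtain S' f where S': "open S'" "S' \<subseteq> S" "\<xi>0 \<in> S'"
    and f: "C1_orthonormal_frame n (Suc (n - 2)) S' (e(n - 2 := f))"
    using C1_orthonormal_frame_extend[OF e n2(1) S(1,3)] by blast
  obtain T g where T: "open T" "T \<subseteq> S'" "\<xi>0 \<in> T"
    and g: "C1_orthonormal_frame n n T (e(n - 2 := f, Suc (n - 2) := g))"
    using C1_orthonormal_frame_extend[OF f n2(2) S'(1,3)] unfolding n2(3) by blast
  obtain a b where ab: "box a b \<subseteq> T" "\<xi>0 \<in> box a b"
    by (rule open_contains_box[OF T(1,3)], rule that)
  let ?R = "box a b"
  have R\<Omega>: "?R \<subseteq> \<Omega>" and RS: "?R \<subseteq> S"
    using ab T S S' by blast+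
  \<comment> \<open>the two added vectors come first, as the block \<open>P\<close> is the upper left one\<close>
  define F where "F k = (e(n - 2 := f, Suc (n - 2) := g)) (if k < 2 then n - 2 + k else k - 2)" for k
  have C1F: "C1_on ?R (\<lambda>\<xi>. F k \<xi> i)" if "k < n" "i < n" for k i
  proof (rule C1_on_subset[OF _ ab(1)])
    have "(if k < 2 then n - 2 + k else k - 2) < n"
      using that by auto
    then show "C1_on T (\<lambda>\<xi>. F k \<xi> i)"
      using g that(2) unfolding F_def C1_orthonormal_frame_def by blast
  qed
  have orth: "cip n (F k \<xi>) (F l \<xi>) = (if k = l then 1 else 0)" if "\<xi> \<in> ?R" "k < n" "l < n" for \<xi> k l
  proof -
    let ?p = "\<lambda>k. if k < 2 then n - 2 + k else k - 2"
    have "?p k < n" "?p l < n" "?p k = ?p l \<longleftrightarrow> k = l"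
      using that n_ge_2 by auto
    moreover have "\<xi> \<in> T"
      using that(1) ab(1) by blast
    ultimately have "cip n (F k \<xi>) (F l \<xi>) = (if ?p k = ?p l then 1 else 0)"
      using g unfolding F_def C1_orthonormal_frame_def by blast
    then show ?thesis
      using \<open>?p k = ?p l \<longleftrightarrow> k = l\<close> by simp
  qed
  have eigF: "mat_app n (A \<xi>) (F (k + 2) \<xi>) i = of_real (lam (kept k) \<xi>) * F (k + 2) \<xi> i"
    if "\<xi> \<in> ?R" "k < n - 2" "i < n" for \<xi> k i
  proof -
    have "F (k + 2) = e k"
      unfolding F_def using that(2) by simp
    moreover have "\<xi> \<in> S"
      using that(1) RS by blast
    ultimately show ?thesis
      using eig[OF _ that(2,3)] by simp
  qed
  define U where "U \<xi> = Matrix.mat n n (\<lambda>(i, k). F k \<xi> i)" for \<xi>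
  define P where "P \<xi> = Matrix.mat 2 2 (\<lambda>(k, l). cip n (F k \<xi>) (mat_app n (A \<xi>) (F l \<xi>)))" for \<xi>
  have C1A: "C1_on ?R (\<lambda>\<xi>. A \<xi> $$ (i, k))" if "i < n" "k < n" for i k
    using C1_mat_on_subset[OF C1_A R\<Omega>] that unfolding C1_mat_on_def by blast
  have nm: "n = n - 2 + 2"
    using n_ge_2 by simp
  note schur = block_schur_of_orthonormal_basis[OF hermitian_A nm orth eigF]
  have "C1_block_schur n h lam A ?R U P"
    unfolding C1_block_schur_def
  proof (intro conjI ballI)
    show "C1_mat_on n n ?R U"
      unfolding C1_mat_on_def U_def using C1F by auto
    show "C1_mat_on 2 2 ?R P"
      unfolding C1_mat_on_def P_def using n_ge_2
      by (auto simp: mat_app_def intro!: C1_on_cip C1_on_intros C1F C1A)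
    show "C1_mat_on (n - 2) (n - 2) ?R (remaining_diag n h lam)"
      unfolding C1_mat_on_def
    proof (intro conjI ballI allI impI)
      show "C1_on ?R (\<lambda>\<xi>. remaining_diag n h lam \<xi> $$ (i, j))" if ij: "i < n - 2" "j < n - 2" for i j
      proof (cases "i = j")
        case True
        then show ?thesis
          using ij C1_on_of_real[OF C1_on_subset[OF C1_simple_lam[OF kept_mem[OF ij(2)]] R\<Omega>]]
          by (simp add: remaining_diag_eq mat_diag_def)
      next
        case False
        then show ?thesis
          using ij by (simp add: remaining_diag_eq mat_diag_def C1_on_const)
      qed
    qed (simp add: remaining_diag_eq)
  next
    fix \<xi> assume \<xi>: "\<xi> \<in> ?R"
    then have \<xi>': "\<xi> \<in> \<Omega>"
      using R\<Omega> by blast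
    show "unitary_mat n (U \<xi>)" "hermitian_mat 2 (P \<xi>)"
      and "A \<xi> = U \<xi> * four_block_mat (P \<xi>) (0\<^sub>m 2 (n - 2)) (0\<^sub>m (n - 2) 2) (remaining_diag n h lam \<xi>)
        * mat_adjoint (U \<xi>)"
      unfolding U_def P_def remaining_diag_eq using schur[OF \<xi>' \<xi> _ _ \<xi>] by blast+
    have "char_poly (A \<xi>) = char_poly (P \<xi>) * (\<Prod>i<n - 2. [:- of_real (lam (kept i) \<xi>), 1:])"
      unfolding P_def using schur(4)[OF \<xi>' \<xi> _ _ \<xi>] by blast
    moreover have "(\<Prod>i<n - 2. [:- complex_of_real (lam (kept i) \<xi>), 1:]) \<noteq> 0"
      by simp
    ultimately show "eigenvalue_list (P \<xi>) [complex_of_real (lam h \<xi>), complex_of_real (lam (h + 1) \<xi>)]"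
      unfolding eigenvalue_list_def char_poly_A_kept[OF \<xi>'] by (simp only: mult_cancel_right) simp
  qed
  then show thesis
    by (rule that[OF open_box is_interval_box R\<Omega> ab(2)])
qed

end

section \<open>The discriminant along lines through a coalescence point\<close>

unbundle vec_syntax

lemma det_2x2:
  fixes B :: "complex mat"
  assumes "B \<in> carrier_mat 2 2"
  shows "Determinant.det B = B $$ (0, 0) * B $$ (1, 1) - B $$ (0, 1) * B $$ (1, 0)"
proof -
  have "mat_delete B i j $$ (0, 0) = B $$ (1 - i, 1 - j)" "mat_delete B i j \<in> carrier_mat 1 1"
    if "i < 2" "j < 2" for i j
    using assms that mat_delete_carrier[OF assms, of i j] unfolding mat_delete_def by (auto simp: less_Suc_eq numeral_2_eq_2)
  then show ?thesis
    using laplace_expansion_row[OF assms, of 0]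
    by (simp add: cofactor_def det_single numeral_2_eq_2)
qed

text \<open>
  Comparing the two forms of the characteristic polynomial at \<open>0\<close> and \<open>1\<close> yields determinant and trace;
  the claim is \<open>(x - y)\<^sup>2 = (x + y)\<^sup>2 - 4 x y\<close>.
\<close>

lemma hermitian_2_eigenvalue_gap:
  assumes B: "hermitian_mat 2 B" and eig: "eigenvalue_list B [complex_of_real x, complex_of_real y]"
  shows "(x - y)\<^sup>2 = (Re (B $$ (0, 0)) - Re (B $$ (1, 1)))\<^sup>2
    + 4 * ((Re (B $$ (0, 1)))\<^sup>2 + (Im (B $$ (0, 1)))\<^sup>2)"
proof -
  have Bc: "B \<in> carrier_mat 2 2" and adj: "mat_adjoint B = B"
    using B unfolding hermitian_mat_def by auto
  have entry: "B $$ (k, i) = cnj (B $$ (i, k))" if "i < 2" "k < 2" for i k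
    using mat_adjoint_index[OF Bc that] adj by simp
  have "(z - x) * (z - y) = (z - Re (B $$ (0, 0))) * (z - Re (B $$ (1, 1)))
      - ((Re (B $$ (0, 1)))\<^sup>2 + (Im (B $$ (0, 1)))\<^sup>2)" for z :: real
  proof -
    have "poly (char_poly B) (of_real z) = of_real ((z - x) * (z - y))"
      using eig unfolding eigenvalue_list_def by (simp add: algebra_simps)
    moreover have "poly (char_poly B) (of_real z)
        = (of_real z - B $$ (0, 0)) * (of_real z - B $$ (1, 1)) - B $$ (0, 1) * B $$ (1, 0)"
      unfolding char_poly_matrix[OF Bc] using Bc by (subst det_2x2) (auto simp: char_matrix_def)
    moreover have "B $$ (0, 0) = of_real (Re (B $$ (0, 0)))" "B $$ (1, 1) = of_real (Re (B $$ (1, 1)))"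
      using entry[of 0 0] entry[of 1 1] by (auto simp: complex_eq_iff)
    moreover have "B $$ (0, 1) * B $$ (1, 0) = of_real ((Re (B $$ (0, 1)))\<^sup>2 + (Im (B $$ (0, 1)))\<^sup>2)"
      using entry[of 0 1] by (simp add: complex_mult_cnj)
    ultimately have "complex_of_real ((z - x) * (z - y)) = of_real ((z - Re (B $$ (0, 0))) * (z - Re (B $$ (1, 1)))
      - ((Re (B $$ (0, 1)))\<^sup>2 + (Im (B $$ (0, 1)))\<^sup>2))"
      by (metis of_real_diff of_real_mult)
    then show ?thesis
      using of_real_eq_iff by blast
  qed
  from this[of 0] this[of 1] have "x + y = Re (B $$ (0, 0)) + Re (B $$ (1, 1))"
    and "x * y = Re (B $$ (0, 0)) * Re (B $$ (1, 1)) - ((Re (B $$ (0, 1)))\<^sup>2 + (Im (B $$ (0, 1)))\<^sup>2)"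
    by (simp_all add: algebra_simps)
  moreover have "(x - y)\<^sup>2 = (x + y)\<^sup>2 - 4 * (x * y)"
    by (simp add: power2_eq_square algebra_simps)
  ultimately show ?thesis
    by (simp add: power2_eq_square algebra_simps)
qed

lemma tendsto_directional_quotient:
  fixes F :: "'a::real_normed_vector \<Rightarrow> 'b::real_normed_vector"
  assumes F: "(F has_derivative F') (at a)" and Fa: "F a = 0"
  shows "((\<lambda>t. F (a + t *\<^sub>R v) /\<^sub>R t) \<longlongrightarrow> F' v) (at 0)"
proof -
  have "((\<lambda>t. a + t *\<^sub>R v) has_derivative (\<lambda>t. t *\<^sub>R v)) (at 0)"
    by (auto intro!: derivative_eq_intros)
  moreover have "(F has_derivative F') (at (a + 0 *\<^sub>R v))"
    using F by simp
  ultimately have "((\<lambda>t. F (a + t *\<^sub>R v)) has_derivative (\<lambda>t. F' (t *\<^sub>R v))) (at 0)"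
    by (rule has_derivative_compose)
  then have "(\<lambda>t. norm (F (a + t *\<^sub>R v) - t *\<^sub>R F' v) / norm t) \<midarrow>0\<rightarrow> 0"
    unfolding has_derivative_at using linear_simps(5)[OF has_derivative_bounded_linear[OF F]] Fa by simp
  moreover have "norm (F (a + t *\<^sub>R v) - t *\<^sub>R F' v) / norm t = norm (F (a + t *\<^sub>R v) /\<^sub>R t - F' v)"
    if "t \<noteq> 0" for t
  proof -
    have "F (a + t *\<^sub>R v) - t *\<^sub>R F' v = t *\<^sub>R (F (a + t *\<^sub>R v) /\<^sub>R t - F' v)"
      using that by (simp add: scaleR_diff_right)
    then show ?thesis
      using that by simp
  qed
  then have "\<forall>\<^sub>F t in at 0. norm (F (a + t *\<^sub>R v) - t *\<^sub>R F' v) / norm t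
      = norm (F (a + t *\<^sub>R v) /\<^sub>R t - F' v)"
    by (simp add: eventually_at_filter)
  ultimately have "(\<lambda>t. norm (F (a + t *\<^sub>R v) /\<^sub>R t - F' v)) \<midarrow>0\<rightarrow> 0"
    by (rule Lim_transform_eventually)
  then show ?thesis
    using tendsto_norm_zero_iff LIM_zero_iff by blast
qed

lemma invertible_jacobian_iff:
  fixes F :: "real ^ 'p \<Rightarrow> real ^ 'p"
  assumes F: "(F has_derivative F') (at a)"
  shows "invertible (jacobian F (at a)) \<longleftrightarrow> (\<forall>v. v \<noteq> 0 \<longrightarrow> F' v \<noteq> 0)"
proof -
  have "jacobian F (at a) *v v = F' v" for v
    unfolding jacobian_def frechet_derivative_at[OF F, symmetric]
    by (rule matrix_works[OF has_derivative_linear[OF F, folded linear_matrix_vector_mul_eq]])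
  then show ?thesis
    unfolding invertible_left_inverse matrix_left_invertible_ker by auto
qed


text \<open>
  The function \<open>g\<close> collects the factors of the discriminant that stay positive. Since the gap
  \<open>(l1 - l2)\<^sup>2\<close> is \<open>N F\<close> with a quadratic form \<open>N\<close>, the quotient by \<open>t\<^sup>2\<close> is
  \<open>N (F (a + t v) / t) g (a + t v)\<close>, which converges to \<open>N (DF(a) v) g a\<close>; definiteness of \<open>N\<close> turns
  positivity of this limit into \<open>DF(a) v \<noteq> 0\<close>.
\<close>

lemma generic_coalescence_2_iff:
  fixes P :: "real ^ 3 \<Rightarrow> complex mat" and d :: "real ^ 3 \<Rightarrow> complex"
  assumes S: "open S" "a \<in> S" and P: "C1_mat_on 2 2 S P"
    and herm: "\<And>\<xi>. \<xi> \<in> S \<Longrightarrow> hermitian_mat 2 (P \<xi>)"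
    and eig: "\<And>\<xi>. \<xi> \<in> S \<Longrightarrow> eigenvalue_list (P \<xi>) [complex_of_real (l1 \<xi>), complex_of_real (l2 \<xi>)]"
    and coal: "l1 a = l2 a"
    and d: "\<And>\<xi>. \<xi> \<in> S \<Longrightarrow> d \<xi> = of_real ((l1 \<xi> - l2 \<xi>)\<^sup>2 * g \<xi>)"
    and g: "isCont g a" "g a > 0"
  shows "generic_coalescence_2 S P a \<longleftrightarrow> (\<forall>v. v \<noteq> 0 \<longrightarrow>
    (\<exists>L :: real. L > 0 \<and> ((\<lambda>t :: real. d (a + t *\<^sub>R v) / complex_of_real (t\<^sup>2)) \<longlongrightarrow> complex_of_real L) (at 0)))"
proof -
  define F :: "real ^ 3 \<Rightarrow> real ^ 3" where
    "F \<xi> = vector [Re (P \<xi> $$ (0, 0)) - Re (P \<xi> $$ (1, 1)), Re (P \<xi> $$ (0, 1)), Im (P \<xi> $$ (0, 1))]" for \<xi>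
  define N :: "real ^ 3 \<Rightarrow> real" where "N y = (y $ 1)\<^sup>2 + 4 * ((y $ 2)\<^sup>2 + (y $ 3)\<^sup>2)" for y
  have N_scale: "N (y /\<^sub>R t) = N y / t\<^sup>2" for y t
    by (simp add: N_def power_mult_distrib power_inverse divide_inverse algebra_simps)
  have N_nonneg: "N y \<ge> 0" and N_eq_0: "N y = 0 \<longleftrightarrow> y = 0" for y
    by (auto simp: N_def Finite_Cartesian_Product.vec_eq_iff forall_3 add_nonneg_eq_0_iff)
  have N_pos: "N y > 0 \<longleftrightarrow> y \<noteq> 0" for y
    using N_nonneg[of y] N_eq_0[of y] by linarith
  have gap: "(l1 \<xi> - l2 \<xi>)\<^sup>2 = N (F \<xi>)" if "\<xi> \<in> S" for \<xi>
    using hermitian_2_eigenvalue_gap[OF herm[OF that] eig[OF that]] by (simp add: N_def F_def)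
  \<comment> \<open>the zero is forced by the coalescence, so regularity is a condition on the derivative alone\<close>
  have Fa: "F a = 0"
    using gap[OF S(2)] coal N_eq_0 by simp
  have C1F: "C1_on S F"
    using P unfolding F_def C1_mat_on_def by (intro C1_on_vector_3 C1_on_intros) auto
  obtain D where "\<And>\<xi>. \<xi> \<in> S \<Longrightarrow> (F has_derivative D \<xi>) (at \<xi> within S)"
    by (rule C1_onE[OF C1F]) blast
  from this[OF S(2)] obtain F' where F': "(F has_derivative F') (at a)"
    unfolding at_within_open[OF S(2,1)] by blast
  have "generic_coalescence_2 S P a \<longleftrightarrow> invertible (jacobian F (at a))"
    using S C1F Fa unfolding generic_coalescence_2_def regular_zero_def F_def[symmetric] by blast
  also have "\<dots> \<longleftrightarrow> (\<forall>v. v \<noteq> 0 \<longrightarrow> F' v \<noteq> 0)"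
    by (rule invertible_jacobian_iff[OF F'])
  also have "\<dots> \<longleftrightarrow> (\<forall>v. v \<noteq> 0 \<longrightarrow>
    (\<exists>L :: real. L > 0 \<and> ((\<lambda>t :: real. d (a + t *\<^sub>R v) / complex_of_real (t\<^sup>2)) \<longlongrightarrow> complex_of_real L) (at 0)))"
  proof (intro all_cong1 imp_cong refl)
    fix v
    let ?l = "N (F' v) * g a"
    let ?q = "\<lambda>t :: real. d (a + t *\<^sub>R v) / complex_of_real (t\<^sup>2)"
    have line: "((\<lambda>t. a + t *\<^sub>R v) \<longlongrightarrow> a) (at (0::real))"
      by (auto intro!: tendsto_eq_intros)
    have "((\<lambda>t. N (F (a + t *\<^sub>R v) /\<^sub>R t)) \<longlongrightarrow> N (F' v)) (at 0)"
      unfolding N_def by (intro tendsto_intros tendsto_directional_quotient[OF F' Fa])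
    moreover have "((\<lambda>t. g (a + t *\<^sub>R v)) \<longlongrightarrow> g a) (at 0)"
      by (rule isCont_tendsto_compose[OF g(1) line])
    ultimately have "((\<lambda>t. complex_of_real (N (F (a + t *\<^sub>R v) /\<^sub>R t) * g (a + t *\<^sub>R v))) \<longlongrightarrow> of_real ?l) (at 0)"
      by (intro tendsto_of_real tendsto_mult)
    moreover have "\<forall>\<^sub>F t in at 0. a + t *\<^sub>R v \<in> S"
      using topological_tendstoD[OF line S] .
    then have "\<forall>\<^sub>F t in at 0. complex_of_real (N (F (a + t *\<^sub>R v) /\<^sub>R t) * g (a + t *\<^sub>R v)) = ?q t"
      by eventually_elim (simp add: d gap N_scale)
    ultimately have lim: "(?q \<longlongrightarrow> of_real ?l) (at 0)"
      by (rule Lim_transform_eventually)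
    have "(\<exists>L :: real. L > 0 \<and> (?q \<longlongrightarrow> complex_of_real L) (at 0)) \<longleftrightarrow> ?l > 0"
    proof
      assume "\<exists>L :: real. L > 0 \<and> (?q \<longlongrightarrow> complex_of_real L) (at 0)"
      then obtain L :: real where L: "L > 0" "(?q \<longlongrightarrow> complex_of_real L) (at 0)"
        by blast
      from tendsto_unique[OF at_neq_bot lim L(2)] L(1) show "?l > 0"
        by (simp only: of_real_eq_iff)
    next
      assume "?l > 0"
      then show "\<exists>L :: real. L > 0 \<and> (?q \<longlongrightarrow> complex_of_real L) (at 0)"
        using lim by blast
    qed
    also have "?l > 0 \<longleftrightarrow> F' v \<noteq> 0"
      using g(2) N_pos by (simp add: zero_less_mult_iff)
    finally show "F' v \<noteq> 0 \<longleftrightarrow> (\<exists>L :: real. L > 0 \<and> (?q \<longlongrightarrow> complex_of_real L) (at 0))" ..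
  qed
  finally show ?thesis .
qed

context coalescing_eigenvalues
begin

text \<open>
  With list positions counted from \<open>0\<close>, the coalescing pair sits at the positions \<open>h - 1\<close> and \<open>h\<close>.
\<close>

definition other_gaps :: "real ^ 3 \<Rightarrow> real" where
  "other_gaps \<xi> = (\<Prod>(l, j) \<in> {(l, j). l < j \<and> j < n} - {(h - 1, h)}. (lam (j + 1) \<xi> - lam (l + 1) \<xi>)\<^sup>2)"

lemma discr_A:
  assumes "\<xi> \<in> \<Omega>"
  shows "discr (A \<xi>) = of_real ((lam h \<xi> - lam (h + 1) \<xi>)\<^sup>2 * other_gaps \<xi>)"
proof -
  let ?es = "map (\<lambda>j. complex_of_real (lam j \<xi>)) [1..<n + 1]"
  let ?I = "{(l, j). l < j \<and> j < n}"
  have "discr (A \<xi>) = (\<Prod>(l, j) \<in> {(l, j). l < j \<and> j < length ?es}. (?es ! j - ?es ! l)\<^sup>2)"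
    unfolding prod_pairs_eq_discr_list by (rule discr_eq[OF eigenvalues_A[OF assms]])
  also have "\<dots> = (\<Prod>(l, j) \<in> ?I. complex_of_real ((lam (j + 1) \<xi> - lam (l + 1) \<xi>)\<^sup>2))"
    by (rule prod.cong) (auto simp del: upt_Suc)
  also have "\<dots> = complex_of_real (\<Prod>(l, j) \<in> ?I. (lam (j + 1) \<xi> - lam (l + 1) \<xi>)\<^sup>2)"
    by (simp add: case_prod_unfold)
  also have "(\<Prod>(l, j) \<in> ?I. (lam (j + 1) \<xi> - lam (l + 1) \<xi>)\<^sup>2)
      = (lam (h + 1) \<xi> - lam (h - 1 + 1) \<xi>)\<^sup>2 * other_gaps \<xi>"
    unfolding other_gaps_def using h_ge_1 h_le n_ge_2
    by (subst prod.remove[OF finite_index_pairs, of "(h - 1, h)"]) auto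
  finally show ?thesis
    using h_ge_1 by (simp add: power2_commute)
qed

lemma isCont_other_gaps: "isCont other_gaps \<xi>0"
proof -
  have "continuous_on \<Omega> other_gaps"
    unfolding other_gaps_def case_prod_unfold
    by (intro continuous_intros lam_continuous) auto
  then show ?thesis
    using open_\<Omega> \<xi>0_in by (simp add: continuous_on_eq_continuous_at)
qed

lemma other_gaps_pos: "0 < other_gaps \<xi>0"
  unfolding other_gaps_def
proof (rule prod_pos)
  fix p assume "p \<in> {(l, j). l < j \<and> j < n} - {(h - 1, h)}"
  then obtain l j where p: "p = (l, j)" and lj: "l < j" "j < n" "\<not> (l = h - 1 \<and> j = h)"
    by auto
  have "lam (l + 1) \<xi>0 \<noteq> lam (j + 1) \<xi>0"
  proof
    assume "lam (l + 1) \<xi>0 = lam (j + 1) \<xi>0"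
    then have "l + 1 = h \<and> j + 1 = h + 1"
      using lam_eq_imp[OF \<xi>0_in, of "l + 1" "j + 1"] lj(1,2) by simp
    then show False
      using lj(3) by arith
  qed
  then show "0 < (case p of (l, j) \<Rightarrow> (lam (j + 1) \<xi>0 - lam (l + 1) \<xi>0)\<^sup>2)"
    unfolding p by simp
qed

lemma generic_iff_discr_limit:
  assumes "open S" "S \<subseteq> \<Omega>" "\<xi>0 \<in> S" "C1_mat_on 2 2 S P"
    and "\<And>\<xi>. \<xi> \<in> S \<Longrightarrow> hermitian_mat 2 (P \<xi>)"
    and "\<And>\<xi>. \<xi> \<in> S \<Longrightarrow>
      eigenvalue_list (P \<xi>) [complex_of_real (lam h \<xi>), complex_of_real (lam (h + 1) \<xi>)]"
  shows "generic_coalescence_2 S P \<xi>0 \<longleftrightarrow> (\<forall>v. v \<noteq> 0 \<longrightarrow>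
    (\<exists>L :: real. L > 0 \<and>
      ((\<lambda>t :: real. discr (A (\<xi>0 + t *\<^sub>R v)) / complex_of_real (t\<^sup>2)) \<longlongrightarrow> complex_of_real L) (at 0)))"
proof (rule generic_coalescence_2_iff[where d = "\<lambda>\<xi>. discr (A \<xi>)" and g = other_gaps])
  show "lam h \<xi>0 = lam (h + 1) \<xi>0"
    using coalesce[OF \<xi>0_in h_ge_1] h_le n_ge_2 by auto
  show "discr (A \<xi>) = of_real ((lam h \<xi> - lam (h + 1) \<xi>)\<^sup>2 * other_gaps \<xi>)" if "\<xi> \<in> S" for \<xi>
    using discr_A assms(2) that by blast
qed (use assms isCont_other_gaps other_gaps_pos in auto)

text \<open>
  The right-hand side does not mention the decomposition. Hence whether \<open>\<xi>0\<close> is generic does not depend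
  on the choice of \<open>R\<close>, \<open>U\<close> and \<open>P\<close>, and it may be tested on any single decomposition.
\<close>

lemma generic_block_iff_discr_limit:
  assumes R: "R \<subseteq> \<Omega>" "\<xi>0 \<in> interior R" and schur: "C1_block_schur n h lam A R U P"
  shows "generic_coalescence_2 (interior R) P \<xi>0 \<longleftrightarrow> (\<forall>v. v \<noteq> 0 \<longrightarrow>
    (\<exists>L :: real. L > 0 \<and>
      ((\<lambda>t :: real. discr (A (\<xi>0 + t *\<^sub>R v)) / complex_of_real (t\<^sup>2)) \<longlongrightarrow> complex_of_real L) (at 0)))"
proof (rule generic_iff_discr_limit)
  show "C1_mat_on 2 2 (interior R) P"
    using schur C1_mat_on_subset interior_subset unfolding C1_block_schur_def by blast
  show "interior R \<subseteq> \<Omega>"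
    using R(1) interior_subset by blast
  show "hermitian_mat 2 (P \<xi>)"
    and "eigenvalue_list (P \<xi>) [complex_of_real (lam h \<xi>), complex_of_real (lam (h + 1) \<xi>)]"
    if "\<xi> \<in> interior R" for \<xi>
    using schur interior_subset that unfolding C1_block_schur_def by blast+
qed (use R(2) in auto)

lemma generic_coalescence_iff_discr_limit:
  "generic_coalescence n h lam \<Omega> A \<xi>0 \<longleftrightarrow> (\<forall>v. v \<noteq> 0 \<longrightarrow>
    (\<exists>L :: real. L > 0 \<and>
      ((\<lambda>t :: real. discr (A (\<xi>0 + t *\<^sub>R v)) / complex_of_real (t\<^sup>2)) \<longlongrightarrow> complex_of_real L) (at 0)))"
proof (cases "n = 2")
  case True
  then have h: "h = 1"
    using h_ge_1 h_le by simp
  have "generic_coalescence_2 \<Omega> A \<xi>0 \<longleftrightarrow> (\<forall>v. v \<noteq> 0 \<longrightarrow>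
    (\<exists>L :: real. L > 0 \<and>
      ((\<lambda>t :: real. discr (A (\<xi>0 + t *\<^sub>R v)) / complex_of_real (t\<^sup>2)) \<longlongrightarrow> complex_of_real L) (at 0)))"
  proof (rule generic_iff_discr_limit)
    show "eigenvalue_list (A \<xi>) [complex_of_real (lam h \<xi>), complex_of_real (lam (h + 1) \<xi>)]"
      if "\<xi> \<in> \<Omega>" for \<xi>
      using eigenvalues_A[OF that] True h by (simp add: numeral_2_eq_2)
  qed (use open_\<Omega> \<xi>0_in C1_A hermitian_A True in auto)
  then show ?thesis
    using True unfolding generic_coalescence_def by simp
next
  case False
  obtain R U P where "open R" "is_interval R" "R \<subseteq> \<Omega>" "\<xi>0 \<in> R" and schur: "C1_block_schur n h lam A R U P"
    by (rule C1_block_schur_exists)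
  then have R: "is_interval R" "R \<subseteq> \<Omega>" "\<xi>0 \<in> interior R"
    by (simp_all add: interior_open)
  then show ?thesis
    using generic_block_iff_discr_limit[OF R(2,3) schur] generic_block_iff_discr_limit schur False
    unfolding generic_coalescence_def by (simp only: if_False) blast
qed

end

theorem theorem2p5:
  fixes n h :: nat
    and \<Omega> :: "(real ^ 3) set"
    and A :: "real ^ 3 \<Rightarrow> complex mat"
    and lam :: "nat \<Rightarrow> real ^ 3 \<Rightarrow> real"
    and \<xi>0 :: "real ^ 3"
  assumes "n \<ge> 2"
    and "open \<Omega>"
    and "C1_mat_on n n \<Omega> A"
    and "\<And>\<xi>. \<xi> \<in> \<Omega> \<Longrightarrow> hermitian_mat n (A \<xi>)"
    and "\<And>\<xi>. \<xi> \<in> \<Omega> \<Longrightarrow> eigenvalue_list (A \<xi>) (map (\<lambda>j. complex_of_real (lam j \<xi>)) [1..<n + 1])"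
    and "\<And>\<xi> j. \<xi> \<in> \<Omega> \<Longrightarrow> 1 \<le> j \<Longrightarrow> j < n \<Longrightarrow> lam j \<xi> \<ge> lam (j + 1) \<xi>"
    and "\<And>j. 1 \<le> j \<Longrightarrow> j \<le> n \<Longrightarrow> continuous_on \<Omega> (lam j)"
    and "1 \<le> h" and "h \<le> n - 1"
    and "\<xi>0 \<in> \<Omega>"
    and "\<And>\<xi> j. \<xi> \<in> \<Omega> \<Longrightarrow> 1 \<le> j \<Longrightarrow> j < n \<Longrightarrow>
           lam j \<xi> = lam (j + 1) \<xi> \<longleftrightarrow> j = h \<and> \<xi> = \<xi>0"
  shows "generic_coalescence n h lam \<Omega> A \<xi>0 \<longleftrightarrow>
     (\<forall>v :: real ^ 3. v \<noteq> 0 \<longrightarrow>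
        (\<exists>L :: real. L > 0 \<and>
           ((\<lambda>t :: real. discr (A (\<xi>0 + t *\<^sub>R v)) / complex_of_real (t\<^sup>2)) \<longlongrightarrow> complex_of_real L)
             (at 0)))"
  by (rule coalescing_eigenvalues.generic_coalescence_iff_discr_limit[OF coalescing_eigenvalues.intro[OF assms]])

end
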